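(* Assume $N_j>2n_j$ for $j=1,\dots,d$, and fix $\boldsymbol\Sigma=\{\Sigma_{\mathbf k}\}_{\mathbf k\in\Lambda}\in\mathscr{M}_+$. Then the map $\mathbf s(\,\cdot\,,\boldsymbol\Sigma):\Psi\mapsto\mathbf Q$, which assigns to each $\Psi:\mathbb{T}^d_{\mathbf N}\to\mathfrak{H}_{+,m}$ the unique $\mathbf Q$ such that $(\Psi^{-1}+Q)(\boldsymbol\zeta_{\boldsymbol\ell})>0$ for all $\boldsymbol\ell\in\mathbb{Z}^d_{\mathbf N}$ and $$\int_{\mathbb{T}^d}e^{i\langle\mathbf k,\boldsymbol\theta\rangle}(\Psi^{-1}+Q)^{-1}\,\mathrm{d}\nu_{\mathbf N}=\Sigma_{\mathbf k}\quad\text{for all }\mathbf k\in\Lambda,$$ is smooth (of class $C^\infty$).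
   Context: Let $d,m\ge1$ be integers. $\mathfrak{H}_{+,m}$ is the set of $m\times m$ Hermitian positive definite complex matrices; $X>0$ means Hermitian positive definite; $(\cdot)^*$ is conjugate transpose. Fix positive integers $\mathbf N=(N_1,\dots,N_d)$, put $|\mathbf N|=\prod_j N_j$ and $\mathbb{Z}^d_{\mathbf N}=\{\boldsymbol\ell\in\mathbb{Z}^d:0\le\ell_j\le N_j-1,\ j=1,\dots,d\}$. The grid is $\mathbb{T}^d_{\mathbf N}=\{(2\pi\ell_1/N_1,\dots,2\pi\ell_d/N_d):\boldsymbol\ell\in\mathbb{Z}^d_{\mathbf N}\}$, and $\boldsymbol\zeta_{\boldsymbol\ell}=(e^{i2\pi\ell_1/N_1},\dots,e^{i2\pi\ell_d/N_d})$; functions on the grid are written interchangeably as functions of $\boldsymbol\theta$, of $e^{i\boldsymbol\theta}$, or of $\boldsymbol\zeta_{\boldsymbol\ell}$. Integrals against $\nu_{\mathbf N}$ are the averages $\int_{\mathbb{T}^d}f(e^{i\boldsymbol\theta})\,\mathrm{d}\nu_{\mathbf N}=\frac1{|\mathbf N|}\sum_{\boldsymbol\ell\in\mathbb{Z}^d_{\mathbf N}}f(\boldsymbol\zeta_{\boldsymbol\ell})$. $\langle\mathbf k,\boldsymbol\theta\rangle=\sum_jk_j\theta_j$. $\Lambda\subset\mathbb{Z}^d$ is a finite index set with $\mathbf 0\in\Lambda$ and $-\mathbf k\in\Lambda$ whenever $\mathbf k\in\Lambda$; $n_j:=\max\{|k_j|:\mathbf k\in\Lambda\}$. $\mathbf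 Q$ ranges over the finite-dimensional real vector space of families $\{Q_{\mathbf k}\}_{\mathbf k\in\Lambda}$ with $Q_{\mathbf k}\in\mathbb{C}^{m\times m}$ and $Q_{-\mathbf k}=Q_{\mathbf k}^*$, with associated polynomial $Q(e^{i\boldsymbol\theta})=\sum_{\mathbf k\in\Lambda}Q_{\mathbf k}e^{-i\langle\mathbf k,\boldsymbol\theta\rangle}$. $\mathscr{M}_+$ is the set of families $\{\int_{\mathbb{T}^d}e^{i\langle\mathbf k,\boldsymbol\theta\rangle}\Phi\,\mathrm{d}\nu_{\mathbf N}\}_{\mathbf k\in\Lambda}$ where $\Phi$ ranges over all functions $\mathbb{T}^d_{\mathbf N}\to\mathfrak{H}_{+,m}$. The domain of $\mathbf s(\,\cdot\,,\boldsymbol\Sigma)$ is the set of functions $\Psi:\mathbb{T}^d_{\mathbf N}\to\mathfrak{H}_{+,m}$, an open subset of the finite-dimensional real vector space of Hermitian-matrix-valued functions on the grid. Under the stated assumptions the $\mathbf Q$ defining $\mathbf s(\Psi,\boldsymbol\Sigma)$ exists and is unique for each $\Psi$; it is the unique minimizer of $J_\Psi(\mathbf Q)=\sum_{\mathbf k\in\Lambda}\operatorname{tr}(Q_{\mathbf k}\Sigma_{\mathbf k}^* )-\int_{\mathbb{T}^d}\log\det(\Psi^{-1}+Q)\,\mathrm{d}\nu_{\mathbf N}$ over $\{\mathbf Q:(\Psi^{-1}+Q)(\boldsymbol\zeta_{\boldsymbol\ell})>0\ \forall\boldsymbol\ell\in\mathbb{Z}^d_{\mathbf N}\}$. *)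

theory Defs
  imports "HOL-Analysis.Analysis"
begin

definition ctranspose :: "complex^'n^'m \<Rightarrow> complex^'m^'n" where
  "ctranspose A = (\<chi> i j. cnj (A $ j $ i))"

definition hermitian :: "complex^'m^'m \<Rightarrow> bool" where
  "hermitian A \<longleftrightarrow> ctranspose A = A"

text \<open>For hermitian \<open>A\<close> the quadratic form is real, so taking the real part loses nothing.\<close>

definition posdef :: "complex^'m^'m \<Rightarrow> bool" where
  "posdef A \<longleftrightarrow> hermitian A \<and>
     (\<forall>x. x \<noteq> 0 \<longrightarrow> 0 < Re (\<Sum>i\<in>UNIV. cnj (x $ i) * (A *v x) $ i))"

definition cscale :: "complex \<Rightarrow> complex^'n^'m \<Rightarrow> complex^'n^'m" where
  "cscale c A = (\<chi> i j. c * A $ i $ j)"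

text \<open>A function on the grid of angles is a function of the index \<open>l\<close>; only its values for
  \<open>l \<in> grid N\<close> matter.\<close>

definition grid :: "nat^'d \<Rightarrow> (int^'d) set" where
  "grid N = {l. \<forall>j. 0 \<le> l $ j \<and> l $ j \<le> int (N $ j) - 1}"

definition angle :: "nat^'d \<Rightarrow> int^'d \<Rightarrow> real^'d" where
  "angle N l = (\<chi> j. 2 * pi * of_int (l $ j) / of_nat (N $ j))"

definition pairing :: "int^'d \<Rightarrow> real^'d \<Rightarrow> real" where
  "pairing k \<theta> = (\<Sum>j\<in>UNIV. of_int (k $ j) * \<theta> $ j)"

definition grid_avg :: "nat^'d \<Rightarrow> (int^'d \<Rightarrow> 'a) \<Rightarrow> 'a::real_vector" where
  "grid_avg N f = (1 / of_nat (\<Prod>j\<in>UNIV. N $ j)) *\<^sub>R (\<Sum>l\<in>grid N. f l)"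

definition moment :: "nat^'d \<Rightarrow> (int^'d \<Rightarrow> complex^'m^'m) \<Rightarrow> int^'d \<Rightarrow> complex^'m^'m" where
  "moment N \<Phi> k = grid_avg N (\<lambda>l. cscale (cis (pairing k (angle N l))) (\<Phi> l))"

text \<open>Families indexed by \<open>\<Lambda>\<close> are functions on all of \<open>\<int>\<^sup>d\<close> that vanish outside \<open>\<Lambda>\<close>, so
  that equality of functions is equality of families.\<close>

definition families :: "(int^'d) set \<Rightarrow> (int^'d \<Rightarrow> complex^'m^'m) set" where
  "families \<Lambda> = {Q. \<forall>k. k \<notin> \<Lambda> \<longrightarrow> Q k = 0}"

definition Q_space :: "(int^'d) set \<Rightarrow> (int^'d \<Rightarrow> complex^'m^'m) set" where
  "Q_space \<Lambda> = {Q \<in> families \<Lambda>. \<forall>k\<in>\<Lambda>. Q (- k) = ctranspose (Q k)}"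

definition moments_pos :: "nat^'d \<Rightarrow> (int^'d) set \<Rightarrow> (int^'d \<Rightarrow> complex^'m^'m) set" where
  "moments_pos N \<Lambda> = {\<Sigma> \<in> families \<Lambda>.
     \<exists>\<Phi>. (\<forall>l\<in>grid N. posdef (\<Phi> l)) \<and> (\<forall>k\<in>\<Lambda>. \<Sigma> k = moment N \<Phi> k)}"

definition trig_poly ::
  "nat^'d \<Rightarrow> (int^'d) set \<Rightarrow> (int^'d \<Rightarrow> complex^'m^'m) \<Rightarrow> int^'d \<Rightarrow> complex^'m^'m" where
  "trig_poly N \<Lambda> Q l = (\<Sum>k\<in>\<Lambda>. cscale (cis (- pairing k (angle N l))) (Q k))"

definition is_solution ::
  "nat^'d \<Rightarrow> (int^'d) set \<Rightarrow> (int^'d \<Rightarrow> complex^'m^'m) \<Rightarrow> (int^'d \<Rightarrow> complex^'m^'m) \<Rightarrow>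
    (int^'d \<Rightarrow> complex^'m^'m) \<Rightarrow> bool" where
  "is_solution N \<Lambda> \<Psi> \<Sigma> Q \<longleftrightarrow>
     Q \<in> Q_space \<Lambda> \<and>
     (\<forall>l\<in>grid N. posdef (matrix_inv (\<Psi> l) + trig_poly N \<Lambda> Q l)) \<and>
     (\<forall>k\<in>\<Lambda>. moment N (\<lambda>l. matrix_inv (matrix_inv (\<Psi> l) + trig_poly N \<Lambda> Q l)) k = \<Sigma> k)"

definition s_map ::
  "nat^'d \<Rightarrow> (int^'d) set \<Rightarrow> (int^'d \<Rightarrow> complex^'m^'m) \<Rightarrow> (int^'d \<Rightarrow> complex^'m^'m) \<Rightarrow>
    int^'d \<Rightarrow> complex^'m^'m" where
  "s_map N \<Lambda> \<Psi> \<Sigma> = (THE Q. is_solution N \<Lambda> \<Psi> \<Sigma> Q)"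

text \<open>Iterated Frechet differentiability on a subset \<open>U\<close> of a linear subspace \<open>V\<close>, where \<open>U\<close>
  is open in \<open>V\<close>. A derivative within \<open>U\<close> is then determined on \<open>V\<close> (though not off \<open>V\<close>), so
  only directions in \<open>V\<close> occur. For finite-dimensional \<open>V\<close>, continuity of all
  iterated derivatives in fixed directions is continuity of the derivatives themselves.\<close>

primrec Ck_on ::
  "nat \<Rightarrow> 'a::real_normed_vector set \<Rightarrow> 'a set \<Rightarrow> ('a \<Rightarrow> 'b::real_normed_vector) \<Rightarrow> bool" where
  "Ck_on 0 V U f \<longleftrightarrow> continuous_on U f"
| "Ck_on (Suc n) V U f \<longleftrightarrow>
     (\<forall>x\<in>U. f differentiable (at x within U)) \<and>
     (\<forall>v\<in>V. Ck_on n V U (\<lambda>x. frechet_derivative f (at x within U) v))"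

definition smooth_on ::
  "'a::real_normed_vector set \<Rightarrow> 'a set \<Rightarrow> ('a \<Rightarrow> 'b::real_normed_vector) \<Rightarrow> bool" where
  "smooth_on V U f \<longleftrightarrow> (\<forall>n. Ck_on n V U f)"

text \<open>The spaces of grid functions and of families in coordinates: \<open>g\<close> numbers the grid points
  by a finite type \<open>'g\<close>, and \<open>e\<close> enumerates \<open>\<Lambda>\<close> by a finite type \<open>'k\<close>. This makes both spaces
  subspaces of Euclidean types, on which derivatives are available.\<close>

definition herm_functions :: "(complex^'m^'m^'g) set" where
  "herm_functions = {x. \<forall>a. hermitian (x $ a)}"

definition posdef_functions :: "(complex^'m^'m^'g) set" where
  "posdef_functions = {x. \<forall>a. posdef (x $ a)}"

definition s_coord ::
  "nat^'d \<Rightarrow> (int^'d) set \<Rightarrow> (int^'d \<Rightarrow> complex^'m^'m) \<Rightarrow> (int^'d \<Rightarrow> 'g::finite) \<Rightarrow>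
    ('k::finite \<Rightarrow> int^'d) \<Rightarrow> complex^'m^'m^'g \<Rightarrow> complex^'m^'m^'k" where
  "s_coord N \<Lambda> \<Sigma> g e x = (\<chi> b. s_map N \<Lambda> (\<lambda>l. x $ g l) \<Sigma> (e b))"

end

theory Submission
  imports Defs
begin

text \<open>Put \<open>A = \<Psi>\<^sup>-\<^sup>1\<close> and \<open>X = A + Q\<close> on the grid. Let \<open>L\<close> be the space of grid functions \<open>Q\<close> and let
  \<open>\<Phi>\<close> be a positive definite function with the prescribed moments. Orthogonality of the characters,
  which needs \<open>N\<^sub>j > 2 n\<^sub>j\<close>, makes \<open>\<^bold>Q \<mapsto> Q\<close> injective and its adjoint proportional to the moment
  map, so the problem reads: find \<open>X > 0\<close> with \<open>X \<in> A + L\<close> and \<open>X\<^sup>-\<^sup>1 - \<Phi>\<close> orthogonal to \<open>L\<close>.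

  With \<open>p\<close> the orthogonal projection onto \<open>L\<close> and \<open>G X = p (X\<^sup>-\<^sup>1) + (X - p X)\<close>, this is the
  equation \<open>G X = p \<Phi> + (A - p A)\<close>. For \<open>Y, Z > 0\<close> and \<open>D \<noteq> 0\<close> the number \<open>\<langle>D, Y D Z\<rangle>\<close> is positive;
  hence \<open>G\<close> is injective on positive definite functions and its derivative there is invertible.
  Existence follows by the continuity method instead of minimising \<open>J\<^sub>\<Psi>\<close>: the a priori bound
  comes from \<open>\<langle>X - A, X\<^sup>-\<^sup>1 - \<Phi>\<rangle> = 0\<close>. Smoothness is a bootstrap: the derivative of \<open>\<Psi> \<mapsto> X\<close> is an
  expression in \<open>\<Psi>\<^sup>-\<^sup>1\<close> and the inverse of the derivative of \<open>G\<close> at \<open>X\<close>, so it is \<open>C\<^sup>n\<close> if \<open>X\<close> is.\<close>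

section \<open>Calculus of \<open>Ck_on\<close>\<close>

text \<open>Openness of \<open>U\<close> relative to \<open>V\<close> in the form used below: short
  segments in directions of \<open>V\<close> stay in \<open>U\<close>, which is what makes
  directional derivatives within \<open>U\<close> unique.\<close>

locale relatively_open =
  fixes V U :: "'a::real_normed_vector set"
  assumes line_in: "x \<in> U \<Longrightarrow> v \<in> V \<Longrightarrow> \<exists>d>0. \<forall>t. \<bar>t\<bar> < d \<longrightarrow> x + t *\<^sub>R v \<in> U"
begin

text \<open>Restricting \<open>f\<close> to the line through \<open>x\<close> along \<open>v\<close>
  gives a function on an open interval of reals, where derivatives are unique.\<close>

lemma has_derivative_unique_direction:
  assumes x: "x \<in> U" and v: "v \<in> V"
    and F: "(f has_derivative F) (at x within U)" and G: "(f has_derivative G) (at x within U)"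
  shows "F v = G v"
proof -
  obtain d where d: "d > 0" "\<And>t. \<bar>t\<bar> < d \<Longrightarrow> x + t *\<^sub>R v \<in> U"
    using line_in[OF x v] by auto
  have *: "((\<lambda>t. f (x + t *\<^sub>R v)) has_derivative (\<lambda>t. D (t *\<^sub>R v))) (at 0)"
    if D: "(f has_derivative D) (at x within U)" for D
  proof -
    have "((\<lambda>t. x + t *\<^sub>R v) has_derivative (\<lambda>t. t *\<^sub>R v)) (at 0 within {-d<..<d})"
      by (auto intro!: derivative_eq_intros)
    moreover have "(f has_derivative D) (at (x + 0 *\<^sub>R v) within (\<lambda>t. x + t *\<^sub>R v) ` {-d<..<d})"
    proof -
      have "(\<lambda>t. x + t *\<^sub>R v) ` {-d<..<d} \<subseteq> U" using d(2) by (auto simp: abs_less_iff)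
      then show ?thesis using has_derivative_subset[OF D] by simp
    qed
    ultimately have "((\<lambda>t. f (x + t *\<^sub>R v)) has_derivative (\<lambda>t. D (t *\<^sub>R v))) (at 0 within {-d<..<d})"
      by (rule has_derivative_in_compose)
    then show ?thesis
      using d(1) by (subst (asm) at_within_open) auto
  qed
  have "(\<lambda>t. F (t *\<^sub>R v)) = (\<lambda>t. G (t *\<^sub>R v))"
    by (rule has_derivative_unique[OF *[OF F] *[OF G]])
  then show ?thesis by (metis scaleR_one)
qed

text \<open>Functions that agree on \<open>U\<close> have the same set of derivatives within
  \<open>U\<close>, so the choice made by \<open>frechet_derivative\<close> is literally the same
  function, even in directions where the derivative is not unique.\<close>

lemma Ck_on_cong: "(\<And>x. x \<in> U \<Longrightarrow> f x = g x) \<Longrightarrow> Ck_on n V U f \<longleftrightarrow> Ck_on n V U g"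
proof (induction n arbitrary: f g)
  case 0
  then show ?case using continuous_on_cong by force
next
  case (Suc n)
  have "(f has_derivative D) (at x within U) \<longleftrightarrow> (g has_derivative D) (at x within U)" if "x \<in> U" for x D
    using has_derivative_transform[OF that, of f g] has_derivative_transform[OF that, of g f] Suc.prems
    by metis
  then have eq: "frechet_derivative f (at x within U) = frechet_derivative g (at x within U)"
    "f differentiable (at x within U) \<longleftrightarrow> g differentiable (at x within U)" if "x \<in> U" for x
    using that by (simp_all add: frechet_derivative_def differentiable_def)
  have "Ck_on n V U (\<lambda>x. frechet_derivative f (at x within U) v)
      \<longleftrightarrow> Ck_on n V U (\<lambda>x. frechet_derivative g (at x within U) v)" for v
    by (rule Suc.IH) (simp add: eq)
  then show ?case using eq(2) by simp
qed

text \<open>\<open>Ck_on\<close> refers to the derivative picked by a choice operator. This rule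
  accepts an arbitrary family of derivatives, because in directions of \<open>V\<close> they all
  agree with the chosen one.\<close>

lemma Ck_on_SucI:
  assumes "\<And>x. x \<in> U \<Longrightarrow> (f has_derivative F x) (at x within U)"
    and "\<And>v. v \<in> V \<Longrightarrow> Ck_on n V U (\<lambda>x. F x v)"
  shows "Ck_on (Suc n) V U f"
proof -
  have D: "f differentiable (at x within U)" if "x \<in> U" for x
    using assms(1) that by (auto simp: differentiable_def)
  moreover have "Ck_on n V U (\<lambda>x. frechet_derivative f (at x within U) v)" if v: "v \<in> V" for v
  proof -
    have "F x v = frechet_derivative f (at x within U) v" if "x \<in> U" for x
      using has_derivative_unique_direction[OF that v assms(1)[OF that]] D[OF that]
      by (simp add: frechet_derivative_works)
    from Ck_on_cong[OF this] show ?thesis using assms(2)[OF v] by simp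
  qed
  ultimately show ?thesis by simp
qed

lemma Ck_on_Suc_iff:
  "Ck_on (Suc n) V U f \<longleftrightarrow>
    (\<exists>F. (\<forall>x\<in>U. (f has_derivative F x) (at x within U)) \<and> (\<forall>v\<in>V. Ck_on n V U (\<lambda>x. F x v)))"
    (is "_ \<longleftrightarrow> (\<exists>F. ?P F)")
proof
  assume "Ck_on (Suc n) V U f"
  then have "?P (\<lambda>x. frechet_derivative f (at x within U))"
    by (simp add: frechet_derivative_works)
  then show "\<exists>F. ?P F" by (rule exI[where x = "\<lambda>x. frechet_derivative f (at x within U)"])
next
  assume "\<exists>F. ?P F"
  then obtain F where "?P F" ..
  then show "Ck_on (Suc n) V U f" by (intro Ck_on_SucI[of f F]) auto
qed

lemma Ck_on_continuous_on: "Ck_on n V U f \<Longrightarrow> continuous_on U f"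
  by (cases n) (auto simp: continuous_on_eq_continuous_within intro: differentiable_imp_continuous_within)

lemma Ck_on_Suc_imp: "Ck_on (Suc n) V U f \<Longrightarrow> Ck_on n V U f"
proof (induction n arbitrary: f)
  case 0
  then show ?case using Ck_on_continuous_on by (metis Ck_on.simps(1))
next
  case (Suc n)
  then show ?case by (metis Ck_on.simps(2))
qed

lemma Ck_on_const: "Ck_on n V U (\<lambda>x. c)"
proof (induction n arbitrary: c)
  case (Suc n)
  show ?case by (rule Ck_on_SucI[where F = "\<lambda>x v. 0"]) (auto intro: Suc)
qed simp

lemma Ck_on_id: "Ck_on n V U (\<lambda>x. x)"
proof (cases n)
  case (Suc n)
  show ?thesis unfolding Suc by (rule Ck_on_SucI[where F = "\<lambda>x v. v"]) (auto intro: Ck_on_const)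
qed simp

lemma Ck_on_add: "Ck_on n V U f \<Longrightarrow> Ck_on n V U g \<Longrightarrow> Ck_on n V U (\<lambda>x. f x + g x)"
proof (induction n arbitrary: f g)
  case 0
  then show ?case by (auto intro: continuous_intros)
next
  case (Suc n)
  obtain F where F: "\<forall>x\<in>U. (f has_derivative F x) (at x within U)" "\<forall>v\<in>V. Ck_on n V U (\<lambda>x. F x v)"
    using Suc.prems(1) unfolding Ck_on_Suc_iff by blast
  obtain G where G: "\<forall>x\<in>U. (g has_derivative G x) (at x within U)" "\<forall>v\<in>V. Ck_on n V U (\<lambda>x. G x v)"
    using Suc.prems(2) unfolding Ck_on_Suc_iff by blast
  show ?case
  proof (rule Ck_on_SucI)
    show "((\<lambda>x. f x + g x) has_derivative (\<lambda>v. F x v + G x v)) (at x within U)" if "x \<in> U" for x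
      by (rule has_derivative_add[OF F(1)[rule_format, OF that] G(1)[rule_format, OF that]])
    show "Ck_on n V U (\<lambda>x. F x v + G x v)" if "v \<in> V" for v
      by (rule Suc.IH[OF F(2)[rule_format, OF that] G(2)[rule_format, OF that]])
  qed
qed

lemma Ck_on_linear:
  assumes L: "bounded_linear L"
  shows "Ck_on n V U f \<Longrightarrow> Ck_on n V U (\<lambda>x. L (f x))"
proof (induction n arbitrary: f)
  case 0
  then show ?case by (auto intro: bounded_linear.continuous_on[OF L])
next
  case (Suc n)
  obtain F where F: "\<forall>x\<in>U. (f has_derivative F x) (at x within U)" "\<forall>v\<in>V. Ck_on n V U (\<lambda>x. F x v)"
    using Suc.prems unfolding Ck_on_Suc_iff by blast
  show ?case
  proof (rule Ck_on_SucI)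
    show "((\<lambda>x. L (f x)) has_derivative (\<lambda>v. L (F x v))) (at x within U)" if "x \<in> U" for x
      by (rule bounded_linear.has_derivative[OF L F(1)[rule_format, OF that]])
    show "Ck_on n V U (\<lambda>x. L (F x v))" if "v \<in> V" for v
      by (rule Suc.IH[OF F(2)[rule_format, OF that]])
  qed
qed

lemma Ck_on_minus: "Ck_on n V U f \<Longrightarrow> Ck_on n V U (\<lambda>x. - f x)"
  by (rule Ck_on_linear[OF bounded_linear_minus[OF bounded_linear_ident]])

lemma Ck_on_diff: "Ck_on n V U f \<Longrightarrow> Ck_on n V U g \<Longrightarrow> Ck_on n V U (\<lambda>x. f x - g x)"
  using Ck_on_add[OF _ Ck_on_minus] by fastforce

lemma Ck_on_bilinear:
  assumes b: "bounded_bilinear b"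
  shows "Ck_on n V U f \<Longrightarrow> Ck_on n V U g \<Longrightarrow> Ck_on n V U (\<lambda>x. b (f x) (g x))"
proof (induction n arbitrary: f g)
  case 0
  then show ?case by (auto intro: bounded_bilinear.continuous_on[OF b])
next
  case (Suc n)
  obtain F where F: "\<forall>x\<in>U. (f has_derivative F x) (at x within U)" "\<forall>v\<in>V. Ck_on n V U (\<lambda>x. F x v)"
    using Suc.prems(1) unfolding Ck_on_Suc_iff by blast
  obtain G where G: "\<forall>x\<in>U. (g has_derivative G x) (at x within U)" "\<forall>v\<in>V. Ck_on n V U (\<lambda>x. G x v)"
    using Suc.prems(2) unfolding Ck_on_Suc_iff by blast
  show ?case
  proof (rule Ck_on_SucI)
    show "((\<lambda>x. b (f x) (g x)) has_derivative (\<lambda>v. b (f x) (G x v) + b (F x v) (g x))) (at x within U)"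
      if "x \<in> U" for x
      by (rule bounded_bilinear.FDERIV[OF b F(1)[rule_format, OF that] G(1)[rule_format, OF that]])
    \<comment> \<open>Each summand of the product rule keeps one undifferentiated factor; the
      assumption of order \<open>Suc n\<close> supplies it at order \<open>n\<close>.\<close>
    show "Ck_on n V U (\<lambda>x. b (f x) (G x v) + b (F x v) (g x))" if "v \<in> V" for v
      using Suc.prems[THEN Ck_on_Suc_imp] F(2) G(2) that by (intro Ck_on_add Suc.IH) blast+
  qed
qed

end

text \<open>A normed algebra whose norm is submultiplicative only up to a constant. It is
  instantiated twice: by the pointwise product of matrix functions, and by composition of bounded
  linear maps, where the derivative of \<open>G\<close> has to be inverted.\<close>

locale unital_bilinear = bounded_bilinear m for m :: "'a::real_normed_vector \<Rightarrow> 'a \<Rightarrow> 'a" +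
  fixes e :: 'a
  assumes assoc: "m (m x y) z = m x (m y z)"
    and left_unit [simp]: "m e x = x" and right_unit [simp]: "m x e = x"
begin

text \<open>The resolvent identity. Besides the regularity of inversion it also yields uniqueness of
  the solution in \<open>sol_unique\<close>.\<close>

lemma inverse_diff:
  assumes "m h' f' = e" and "m f h = e"
  shows "h' - h = - m h' (m (f' - f) h)"
proof -
  have "m h' (m (f' - f) h) = m (m h' f') h - m h' (m f h)"
    by (simp add: diff_left diff_right assoc)
  then show ?thesis using assms by simp
qed

lemma continuous_within_inverse:
  assumes cont: "continuous (at x within U) f" and x: "x \<in> U"
    and inv: "\<And>y. y \<in> U \<Longrightarrow> m (h y) (f y) = e" "\<And>y. y \<in> U \<Longrightarrow> m (f y) (h y) = e"
  shows "continuous (at x within U) h"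
proof -
  obtain K where K: "K > 0" "\<And>a b. norm (m a b) \<le> norm a * norm b * K"
    using pos_bounded by auto
  have le: "norm (h y - h x) \<le> norm (h y) * norm (f y - f x) * (norm (h x) * K\<^sup>2)" if "y \<in> U" for y
  proof -
    have "norm (h y - h x) = norm (m (h y) (m (f y - f x) (h x)))"
      using inverse_diff[OF inv(1)[OF that] inv(2)[OF x]] by simp
    also have "\<dots> \<le> norm (h y) * norm (m (f y - f x) (h x)) * K"
      by (rule K)
    also have "\<dots> \<le> norm (h y) * (norm (f y - f x) * norm (h x) * K) * K"
      using K by (intro mult_right_mono mult_left_mono) auto
    finally show ?thesis by (simp add: power2_eq_square mult_ac)
  qed
  \<comment> \<open>With this \<open>c\<close> the estimate \<open>le\<close> bounds
    \<open>norm (h y - h x)\<close> by \<open>norm (h y) * norm (f y - f x) * c\<close>, which still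
    contains the unknown \<open>norm (h y)\<close>. If
    \<open>norm (f y - f x) < 1 / (2 * (c + 1))\<close>, the bound is at most
    \<open>norm (h y) / 2\<close>, whence \<open>norm (h y) \<le> 2 * norm (h x)\<close>. The
    summand 1 keeps the threshold finite when \<open>c = 0\<close>.\<close>
  define c where "c = norm (h x) * K\<^sup>2"
  have c: "c \<ge> 0" by (simp add: c_def)
  have lim: "((\<lambda>y. norm (f y - f x)) \<longlongrightarrow> 0) (at x within U)"
    using cont by (simp add: continuous_within LIM_zero_iff tendsto_norm_zero_iff)
  have "\<forall>\<^sub>F y in at x within U. norm (f y - f x) < 1 / (2 * (c + 1))"
    using c by (intro order_tendstoD(2)[OF lim]) (auto simp: divide_pos_pos)
  then have "\<forall>\<^sub>F y in at x within U. norm (h y - h x) \<le> 2 * norm (h x) * c * norm (f y - f x)"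
    unfolding eventually_at_filter
  proof eventually_elim
    case (elim y)
    show ?case
    proof (intro impI)
      assume "y \<noteq> x" and y: "y \<in> U"
      with elim have small: "norm (f y - f x) < 1 / (2 * (c + 1))" by simp
      have "norm (f y - f x) * c \<le> 1 / 2"
      proof -
        have "norm (f y - f x) * c \<le> 1 / (2 * (c + 1)) * c"
          using small c by (intro mult_right_mono) auto
        also have "\<dots> \<le> 1 / 2" using c by (simp add: field_simps)
        finally show ?thesis .
      qed
      then have "norm (h y) * (norm (f y - f x) * c) \<le> norm (h y) * (1 / 2)"
        by (intro mult_left_mono) auto
      then have *: "norm (h y - h x) \<le> norm (h y) / 2"
        using le[OF y] by (simp add: c_def mult.assoc)
      have "norm (h y) \<le> 2 * norm (h x)"
        using * norm_triangle_sub[of "h y" "h x"] by linarith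
      then have "norm (h y) * norm (f y - f x) * c \<le> 2 * norm (h x) * norm (f y - f x) * c"
        using c by (intro mult_right_mono) auto
      then show "norm (h y - h x) \<le> 2 * norm (h x) * c * norm (f y - f x)" using le[OF y] by (simp add: c_def mult_ac)
    qed
  qed
  moreover have "((\<lambda>y. 2 * norm (h x) * c * norm (f y - f x)) \<longlongrightarrow> 0) (at x within U)"
    using tendsto_mult_right_zero[OF lim] .
  ultimately have "((\<lambda>y. h y - h x) \<longlongrightarrow> 0) (at x within U)"
    using Lim_null_comparison by fastforce
  then show ?thesis by (simp add: continuous_within LIM_zero_iff)
qed

lemma has_derivative_inverse:
  assumes f: "(f has_derivative F) (at x within U)" and x: "x \<in> U"
    and inv: "\<And>y. y \<in> U \<Longrightarrow> m (h y) (f y) = e" "\<And>y. y \<in> U \<Longrightarrow> m (f y) (h y) = e"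
  shows "(h has_derivative (\<lambda>v. - m (h x) (m (F v) (h x)))) (at x within U)"
proof -
  have cont: "(h \<longlongrightarrow> h x) (at x within U)"
    using continuous_within_inverse[OF has_derivative_continuous[OF f] x inv] by (simp add: continuous_within)
  have F: "bounded_linear F" by (rule has_derivative_bounded_linear[OF f])
  have lin: "bounded_linear (\<lambda>v. - m (h x) (m (F v) (h x)))"
    by (intro bounded_linear_minus bounded_linear_compose[OF bounded_linear_right]
        bounded_linear_compose[OF bounded_linear_left] F)
  define R where "R y = norm (f y - f x - F (y - x)) / norm (y - x)" for y
  have R: "(R \<longlongrightarrow> 0) (at x within U)"
    using f unfolding has_derivative_iff_norm R_def by blast
  obtain C where C: "\<And>v. norm (F v) \<le> norm v * C" "C > 0"
    using bounded_linear.pos_bounded[OF F] by auto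
  obtain K where K: "K > 0" "\<And>a b. norm (m a b) \<le> norm a * norm b * K"
    using pos_bounded by auto
  have K3: "norm (m a (m b c)) \<le> norm a * norm b * norm c * K\<^sup>2" for a b c
  proof -
    have "norm (m a (m b c)) \<le> norm a * norm (m b c) * K" by (rule K)
    also have "\<dots> \<le> norm a * (norm b * norm c * K) * K"
      using K by (intro mult_right_mono mult_left_mono) auto
    finally show ?thesis by (simp add: power2_eq_square mult_ac)
  qed
  \<comment> \<open>The two terms bound the two errors: replacing \<open>h y\<close> by
    \<open>h x\<close> in the outer factor, and linearising \<open>f\<close> with relative remainder
    \<open>R\<close>. Both tend to 0, by continuity of \<open>h\<close> and by differentiability of
    \<open>f\<close>.\<close>
  let ?B = "\<lambda>y. norm (h y - h x) * C * norm (h x) * K\<^sup>2 + norm (h y) * R y * norm (h x) * K\<^sup>2"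
  have "(?B \<longlongrightarrow> norm (h x - h x) * C * norm (h x) * K\<^sup>2 + norm (h x) * 0 * norm (h x) * K\<^sup>2) (at x within U)"
    by (intro tendsto_intros cont R)
  then have lim: "(?B \<longlongrightarrow> 0) (at x within U)" by simp
  have "norm (h y - h x - - m (h x) (m (F (y - x)) (h x))) / norm (y - x) \<le> ?B y"
    if y: "y \<in> U" "y \<noteq> x" for y
  proof -
    have "h y - h x - - m (h x) (m (F (y - x)) (h x))
        = - m (h y) (m (f y - f x) (h x)) + m (h x) (m (F (y - x)) (h x))"
      using inverse_diff[OF inv(1)[OF y(1)] inv(2)[OF x]] by simp
    also have "\<dots> = - m (h y - h x) (m (F (y - x)) (h x)) - m (h y) (m (f y - f x - F (y - x)) (h x))"
      by (simp add: diff_left diff_right)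
    also have "norm \<dots> \<le> norm (h y - h x) * norm (F (y - x)) * norm (h x) * K\<^sup>2
        + norm (h y) * norm (f y - f x - F (y - x)) * norm (h x) * K\<^sup>2"
      by (rule order_trans[OF norm_triangle_ineq4]) (intro add_mono; simp add: K3)
    also have "\<dots> \<le> norm (h y - h x) * (norm (y - x) * C) * norm (h x) * K\<^sup>2
        + norm (h y) * norm (f y - f x - F (y - x)) * norm (h x) * K\<^sup>2"
      using C by (intro add_mono mult_right_mono mult_left_mono) auto
    also have "\<dots> = ?B y * norm (y - x)"
      using y by (simp add: R_def field_simps)
    finally show ?thesis using y by (simp only: pos_divide_le_eq zero_less_norm_iff right_minus_eq not_False_eq_True)
  qed
  then have le: "\<forall>\<^sub>F y in at x within U. norm (h y - h x - - m (h x) (m (F (y - x)) (h x))) / norm (y - x) \<le> ?B y"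
    by (auto simp: eventually_at_filter)
  have "((\<lambda>y. norm (h y - h x - - m (h x) (m (F (y - x)) (h x))) / norm (y - x)) \<longlongrightarrow> 0) (at x within U)"
    by (rule Lim_null_comparison[OF _ lim]) (use le in simp)
  with lin show ?thesis
    unfolding has_derivative_iff_norm by blast
qed

text \<open>The derivative of the inverse is a product of \<open>h\<close>, the derivative of
  \<open>f\<close> and \<open>h\<close> again, so order \<open>n\<close> for \<open>h\<close> gives
  order \<open>Suc n\<close>.\<close>

lemma Ck_on_inverse:
  assumes UV: "relatively_open V U"
    and inv: "\<And>y. y \<in> U \<Longrightarrow> m (h y) (f y) = e" "\<And>y. y \<in> U \<Longrightarrow> m (f y) (h y) = e"
  shows "Ck_on n V U f \<Longrightarrow> Ck_on n V U h"
proof (induction n)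
  case 0
  then have "continuous (at x within U) h" if "x \<in> U" for x
    using continuous_within_inverse[OF _ that inv] that by (simp add: continuous_on_eq_continuous_within)
  then show ?case by (simp add: continuous_on_eq_continuous_within)
next
  case (Suc n)
  interpret relatively_open V U by (rule UV)
  obtain F where F: "\<forall>x\<in>U. (f has_derivative F x) (at x within U)" "\<forall>v\<in>V. Ck_on n V U (\<lambda>x. F x v)"
    using Suc.prems unfolding Ck_on_Suc_iff by blast
  have "Ck_on n V U h" using Suc Ck_on_Suc_imp by blast
  show ?case
  proof (rule Ck_on_SucI)
    show "(h has_derivative (\<lambda>v. - m (h x) (m (F x v) (h x)))) (at x within U)" if "x \<in> U" for x
      using F(1) that inv by (intro has_derivative_inverse) blast+
    show "Ck_on n V U (\<lambda>x. - m (h x) (m (F x v) (h x)))" if "v \<in> V" for v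
      using \<open>Ck_on n V U h\<close> F(2) that
      by (intro Ck_on_minus Ck_on_bilinear[OF bounded_bilinear_axioms]) blast+
  qed
qed

end

lemma unital_bilinear_blinfun_compose: "unital_bilinear (o\<^sub>L) (id_blinfun :: 'a::real_normed_vector \<Rightarrow>\<^sub>L 'a)"
  by (rule unital_bilinear.intro[OF bounded_bilinear_blinfun_compose], unfold_locales)
    (auto intro!: blinfun_eqI)

section \<open>Positive definite matrices\<close>

lemma inner_mult_left_complex: "inner x (a * y) = inner (cnj a * x) (y::complex)"
  by (simp add: inner_complex_def algebra_simps)

text \<open>On complex vectors \<open>inner\<close> is the real part of the Hermitian inner product,
  so the conjugate transpose is also the adjoint for this real inner product.\<close>

lemma inner_matrix_vector: "inner x (A *v y) = inner (ctranspose A *v x) (y :: complex^'n)"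
  for A :: "complex^'n^'m"
proof -
  have "inner x (A *v y) = (\<Sum>i\<in>UNIV. \<Sum>j\<in>UNIV. inner (cnj (A $ i $ j) * x $ i) (y $ j))"
    by (simp add: inner_vec_def matrix_vector_mult_def inner_sum_right inner_mult_left_complex)
  also have "\<dots> = inner (ctranspose A *v x) y"
    by (subst sum.swap) (simp add: inner_vec_def matrix_vector_mult_def ctranspose_def inner_sum_left)
  finally show ?thesis .
qed

text \<open>For matrices \<open>inner A B\<close> is the real part of the trace of
  \<open>ctranspose A ** B\<close>; right multiplications are adjoint to each other in this
  pairing.\<close>

lemma inner_mul_right: "inner A (B ** C) = inner (A ** ctranspose C) B"
  for A :: "complex^'n^'m" and B :: "complex^'k^'m"
proof -
  have *: "inner a (b * c) = inner (a * cnj c) b" for a b c :: complex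
    by (simp add: inner_complex_def algebra_simps)
  have "inner A (B ** C) = (\<Sum>i\<in>UNIV. \<Sum>j\<in>UNIV. \<Sum>k\<in>UNIV. inner (A $ i $ j * cnj (C $ k $ j)) (B $ i $ k))"
    by (simp add: inner_vec_def matrix_matrix_mult_def inner_sum_right *)
  also have "\<dots> = (\<Sum>i\<in>UNIV. \<Sum>k\<in>UNIV. \<Sum>j\<in>UNIV. inner (A $ i $ j * cnj (C $ k $ j)) (B $ i $ k))"
    by (intro sum.cong[OF refl] sum.swap)
  also have "\<dots> = inner (A ** ctranspose C) B"
    by (simp add: inner_vec_def matrix_matrix_mult_def ctranspose_def inner_sum_left)
  finally show ?thesis .
qed

lemma hermitian_iff: "hermitian A \<longleftrightarrow> (\<forall>i j. A $ j $ i = cnj (A $ i $ j))"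
  unfolding hermitian_def ctranspose_def vec_eq_iff vec_lambda_beta by metis

lemma ctranspose_mult: "ctranspose (A ** B) = ctranspose B ** ctranspose A"
  by (simp add: ctranspose_def matrix_matrix_mult_def vec_eq_iff mult.commute)

lemma ctranspose_mat1 [simp]: "ctranspose (mat 1) = mat 1"
  by (auto simp: ctranspose_def mat_def vec_eq_iff)

lemma form_eq_inner: "Re (\<Sum>i\<in>UNIV. cnj (x $ i) * (y $ i)) = inner x (y :: complex^'m)"
  by (simp add: inner_vec_def inner_complex_def)

lemma posdef_iff: "posdef A \<longleftrightarrow> hermitian A \<and> (\<forall>x. x \<noteq> 0 \<longrightarrow> 0 < inner x (A *v x))"
  unfolding posdef_def form_eq_inner ..

text \<open>The closed counterpart of \<open>posdef\<close>: limits of positive definite matrices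
  and Schur complements are only known to lie here.\<close>

definition psd :: "complex^'m^'m \<Rightarrow> bool" where
  "psd A \<longleftrightarrow> hermitian A \<and> (\<forall>x. 0 \<le> inner x (A *v x))"

lemma posdef_imp_psd: "posdef A \<Longrightarrow> psd A"
  unfolding posdef_iff psd_def by (metis inner_zero_left order.strict_implies_order order_refl)

lemma bounded_bilinear_matrix_vector:
  "bounded_bilinear (\<lambda>(A::complex^'n^'m) x. A *v x)"
proof -
  have "bilinear (\<lambda>(A::complex^'n^'m) x. A *v x)"
    by (auto simp: bilinear_def linear_iff matrix_vector_mult_def vec_eq_iff algebra_simps sum.distrib scaleR_sum_right)
  then show ?thesis by (simp add: bilinear_conv_bounded_bilinear)
qed

lemmas matrix_vector_linear_simps =
  bounded_bilinear.add_left[OF bounded_bilinear_matrix_vector]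
  bounded_bilinear.add_right[OF bounded_bilinear_matrix_vector]
  bounded_bilinear.diff_left[OF bounded_bilinear_matrix_vector]
  bounded_bilinear.diff_right[OF bounded_bilinear_matrix_vector]
  bounded_bilinear.scaleR_left[OF bounded_bilinear_matrix_vector]
  bounded_bilinear.scaleR_right[OF bounded_bilinear_matrix_vector]
  bounded_bilinear.zero_left[OF bounded_bilinear_matrix_vector]
  bounded_bilinear.zero_right[OF bounded_bilinear_matrix_vector]
  bounded_bilinear.sum_left[OF bounded_bilinear_matrix_vector]

lemma psd_form_zero:
  assumes A: "psd A" and x: "inner x (A *v x) = 0"
  shows "A *v x = 0"
proof (rule ccontr)
  let ?z = "A *v x"
  assume "?z \<noteq> 0"
  define q where "q = inner ?z (A *v ?z)"
  define b where "b = inner ?z ?z"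
  \<comment> \<open>Along \<open>x + t *\<^sub>R ?z\<close> the form is
    \<open>t\<^sup>2 * q + 2 * t * b\<close>. This \<open>t\<close> makes it negative; the summand 1
    keeps the denominator positive when \<open>q = 0\<close>.\<close>
  define t where "t = - b / (q + 1)"
  have q: "q \<ge> 0" using A by (simp add: psd_def q_def)
  have b: "b > 0" using \<open>?z \<noteq> 0\<close> by (simp add: b_def)
  have sym: "inner x (A *v ?z) = b"
    using A by (simp add: psd_def hermitian_def inner_matrix_vector[of x] b_def)
  have "0 \<le> inner (x + t *\<^sub>R ?z) (A *v (x + t *\<^sub>R ?z))"
    using A by (simp add: psd_def)
  also have "\<dots> = t\<^sup>2 * q + 2 * t * b"
    using x sym by (simp add: matrix_vector_linear_simps inner_add_left inner_add_right q_def b_def power2_eq_square algebra_simps)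
  also have "b = - t * (q + 1)"
    using q by (simp add: t_def)
  also have "t\<^sup>2 * q + 2 * t * (- t * (q + 1)) = - (t\<^sup>2 * (q + 2))"
    by (simp add: power2_eq_square algebra_simps)
  also have "\<dots> < 0"
    using q b by (simp add: t_def)
  finally show False by simp
qed

section \<open>Rank-one decomposition of positive semidefinite matrices\<close>

definition outer :: "complex^'m \<Rightarrow> complex^'m^'m" where
  "outer u = (\<chi> i j. u $ i * cnj (u $ j))"

lemma outer_zero [simp]: "outer 0 = 0"
  by (simp add: outer_def vec_eq_iff)

lemma inner_outer_mult: "inner H (C ** outer u) = inner (H *v u) (C *v u)" for H :: "complex^'m^'n"
proof -
  have *: "inner a (b * cnj c) = inner (a * c) b" for a b c :: complex
    by (simp add: inner_complex_def algebra_simps)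
  have "(C ** outer u) $ i $ j = (C *v u) $ i * cnj (u $ j)" for i j
    by (simp add: matrix_matrix_mult_def outer_def matrix_vector_mult_def sum_distrib_right mult.assoc)
  then show ?thesis
    by (simp add: inner_vec_def * matrix_vector_mult_def[of H] inner_sum_left)
qed

lemma inner_outer: "inner H (outer u) = inner (H *v u) u"
  using inner_outer_mult[of H "mat 1" u] by simp

lemma outer_mult_vec: "outer u *v x = (\<Sum>j\<in>UNIV. cnj (u $ j) * x $ j) *s u"
  by (simp add: outer_def matrix_vector_mult_def vec_eq_iff sum_distrib_left mult_ac)

lemma inner_scale_self: "inner x (c *s u) = Re (c * (\<Sum>j\<in>UNIV. cnj (x $ j) * u $ j))"
  by (simp add: inner_vec_def inner_complex_def sum_distrib_left algebra_simps sum.distrib sum_subtractf)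

lemma outer_form: "inner x (outer u *v x) = (cmod (\<Sum>j\<in>UNIV. cnj (u $ j) * x $ j))\<^sup>2"
proof -
  define S where "S = (\<Sum>j\<in>UNIV. cnj (u $ j) * x $ j)"
  have "(\<Sum>j\<in>UNIV. cnj (x $ j) * u $ j) = cnj S"
    by (simp add: S_def mult.commute)
  then have "inner x (outer u *v x) = Re (S * cnj S)"
    by (simp only: outer_mult_vec inner_scale_self S_def)
  also have "\<dots> = (cmod S)\<^sup>2"
    by (simp add: cmod_power2) (simp add: power2_eq_square)
  finally show ?thesis by (simp add: S_def)
qed

lemma norm_outer: "norm (outer u) = (norm u)\<^sup>2"
proof -
  have "(\<Sum>j\<in>UNIV. cnj (u $ j) * u $ j) = complex_of_real ((norm u)\<^sup>2)"
    by (simp add: norm_vec_def L2_set_def sum_nonneg mult.commute flip: complex_norm_square)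
  then have "(norm (outer u))\<^sup>2 = ((norm u)\<^sup>2)\<^sup>2"
    using outer_form[of u u] by (simp add: power2_norm_eq_inner inner_outer inner_commute norm_power)
  then show ?thesis by (rule power2_eq_imp_eq) simp_all
qed

lemma matrix_vector_mult_axis: "(A *v axis k 1) $ i = A $ i $ k" for A :: "complex^'n^'m"
  by (simp add: matrix_vector_mult_def axis_def if_distrib[of "\<lambda>x. _ * x"] cong: if_cong)

text \<open>One step of Cholesky elimination: \<open>u\<close> is column \<open>i\<close> divided by
  the root of the pivot. The form of \<open>A - outer u\<close> at \<open>x\<close> is the minimum
  of the form of \<open>A\<close> over all shifts of \<open>x\<close> along axis \<open>i\<close>,
  hence nonnegative.\<close>

lemma psd_schur_complement:
  assumes A: "psd A" and pos: "0 < Re (A $ i $ i)"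
  defines "u \<equiv> (\<chi> k. A $ k $ i / complex_of_real (sqrt (Re (A $ i $ i))))"
  shows "psd (A - outer u)" and "(A - outer u) $ i $ j = 0"
proof -
  have herm: "A $ k $ l = cnj (A $ l $ k)" for k l
    using A unfolding psd_def hermitian_iff by blast
  define \<alpha> where "\<alpha> = Re (A $ i $ i)"
  have \<alpha>: "A $ i $ i = of_real \<alpha>" "\<alpha> > 0"
    using arg_cong[OF herm[of i i], of Im] pos by (auto simp: complex_eq_iff \<alpha>_def)
  have sq: "complex_of_real (sqrt \<alpha>) * complex_of_real (sqrt \<alpha>) = of_real \<alpha>"
    using \<alpha> by (simp flip: of_real_mult)
  have "(A - outer u) $ l $ k = cnj ((A - outer u) $ k $ l)" for k l
    using herm[of l k] by (simp add: outer_def)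
  then have "hermitian (A - outer u)"
    unfolding hermitian_iff by blast
  moreover have "0 \<le> inner x ((A - outer u) *v x)" for x
  proof -
    define c where "c = (A *v x) $ i"
    \<comment> \<open>The shift along axis \<open>i\<close> that minimises the form of
      \<open>A\<close>, namely entry \<open>i\<close> of \<open>A *v x\<close> over the
      pivot.\<close>
    define t where "t = c / of_real \<alpha>"
    define v where "v = t *s axis i 1"
    have v: "inner v y = inner t (y $ i)" for y
    proof -
      have "inner v y = (\<Sum>k\<in>UNIV. if k = i then inner t (y $ k) else 0)"
        unfolding inner_vec_def v_def by (intro sum.cong) (auto simp: axis_def)
      then show ?thesis by simp
    qed
    have Av: "(A *v v) $ i = t * of_real \<alpha>"
      by (simp add: v_def vector_scalar_commute matrix_vector_mult_axis \<alpha>)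
    have tc: "inner t c = (cmod c)\<^sup>2 / \<alpha>" "inner t (t * of_real \<alpha>) = (cmod c)\<^sup>2 / \<alpha>"
      using \<alpha> by (simp_all add: t_def inner_complex_def cmod_def power2_eq_square field_simps)
    have "0 \<le> inner (x - v) (A *v (x - v))"
      using A by (simp add: psd_def)
    also have "\<dots> = inner x (A *v x) - inner x (A *v v) - inner v (A *v x) + inner v (A *v v)"
      by (simp add: matrix_vector_linear_simps inner_diff_left inner_diff_right)
    also have "inner x (A *v v) = inner v (A *v x)"
      using A by (simp add: psd_def hermitian_def inner_matrix_vector[of x] inner_commute)
    finally have le: "0 \<le> inner x (A *v x) - (cmod c)\<^sup>2 / \<alpha>"
      by (simp add: v Av tc flip: c_def)
    have hi: "cnj (A $ j $ i) = A $ i $ j" for j using herm[of i j] by simp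
    have "(\<Sum>j\<in>UNIV. cnj (u $ j) * x $ j) = c / of_real (sqrt \<alpha>)"
      by (simp add: u_def c_def matrix_vector_mult_def sum_divide_distrib hi flip: \<alpha>_def)
    then have "inner x (outer u *v x) = (cmod c)\<^sup>2 / \<alpha>"
      using \<alpha> by (simp add: outer_form norm_divide power_divide)
    then show ?thesis using le by (simp add: matrix_vector_linear_simps inner_diff_right)
  qed
  ultimately show "psd (A - outer u)" by (simp add: psd_def)
  show "(A - outer u) $ i $ j = 0"
    using \<alpha> herm[of i j] sq by (simp add: outer_def u_def flip: \<alpha>_def)
qed

text \<open>Cholesky elimination, where \<open>S\<close> contains the rows that may still be
  non-zero. A zero pivot annihilates its whole row and column by \<open>psd_form_zero\<close>, so
  the zero vector serves for that index.\<close>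

lemma psd_decomp_aux:
  assumes "finite S" "psd A" "\<And>i j. i \<notin> S \<Longrightarrow> A $ i $ j = 0"
  shows "\<exists>u. A = (\<Sum>i\<in>S. outer (u i))"
  using assms
proof (induction S arbitrary: A rule: finite_induct)
  case empty
  then show ?case by (simp add: vec_eq_iff)
next
  case (insert i S)
  have herm: "A $ k $ l = cnj (A $ l $ k)" for k l
    using insert.prems(1) unfolding psd_def hermitian_iff by blast
  have diag: "inner (axis i 1) (A *v axis i 1) = Re (A $ i $ i)"
    by (simp add: inner_axis' matrix_vector_mult_axis inner_complex_def)
  have upd: "(\<Sum>k\<in>insert i S. outer ((u(i := w)) k)) = outer w + (\<Sum>k\<in>S. outer (u k))" for u w
  proof -
    have "(\<Sum>k\<in>S. outer ((u(i := w)) k)) = (\<Sum>k\<in>S. outer (u k))"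
      using insert.hyps by (intro sum.cong) auto
    then show ?thesis using insert.hyps by simp
  qed
  show ?case
  proof (cases "Re (A $ i $ i) = 0")
    case True
    then have "A *v axis i 1 = 0"
      using psd_form_zero[OF insert.prems(1)] diag by metis
    then have "A $ k $ i = 0" for k
      by (simp add: matrix_vector_mult_axis vec_eq_iff)
    then have "A $ i $ k = 0" for k using herm[of i k] by simp
    then have "A $ k $ j = 0" if "k \<notin> S" for k j
      using insert.prems(2) that by (cases "k = i") auto
    from insert.IH[OF insert.prems(1) this] obtain u where "A = (\<Sum>i\<in>S. outer (u i))" by blast
    then have "A = (\<Sum>k\<in>insert i S. outer ((u(i := 0)) k))" using upd[of u 0] by simp
    then show ?thesis by (rule exI[where x = "u(i := 0)"])
  next
    case False
    have "0 \<le> Re (A $ i $ i)" using insert.prems(1) diag unfolding psd_def by metis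
    with False have pos: "0 < Re (A $ i $ i)" by simp
    define w where "w = (\<chi> k. A $ k $ i / complex_of_real (sqrt (Re (A $ i $ i))))"
    have "(A - outer w) $ k $ j = 0" if "k \<notin> S" for k j
    proof (cases "k = i")
      case True
      then show ?thesis unfolding w_def by (simp only: psd_schur_complement(2)[OF insert.prems(1) pos])
    next
      case False
      then show ?thesis using insert.prems(2)[of k] that by (simp add: w_def outer_def)
    qed
    from insert.IH[OF psd_schur_complement(1)[OF insert.prems(1) pos] this[unfolded w_def]]
    obtain u where "A - outer w = (\<Sum>i\<in>S. outer (u i))" by (auto simp: w_def)
    then have "A = outer w + (\<Sum>i\<in>S. outer (u i))" by (simp add: algebra_simps)
    then have "A = (\<Sum>k\<in>insert i S. outer ((u(i := w)) k))" using upd[of u w] by simp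
    then show ?thesis by (rule exI[where x = "u(i := w)"])
  qed
qed

lemma psd_decomp:
  fixes A :: "complex^'m^'m"
  assumes "psd A"
  obtains u :: "'m \<Rightarrow> complex^'m" where "A = (\<Sum>i\<in>UNIV. outer (u i))"
  using psd_decomp_aux[OF _ assms, of UNIV] by auto

text \<open>Writing \<open>A\<close> as a sum of rank-one matrices \<open>outer (u i)\<close> turns
  the pairing into the sum of the forms of \<open>B\<close> at the vectors \<open>u i\<close>, while
  \<open>norm (outer (u i))\<close> is the squared norm of \<open>u i\<close>. This is the source of
  the a priori bounds.\<close>

lemma psd_inner_ge:
  fixes A B :: "complex^'m^'m"
  assumes A: "psd A" and B: "\<And>x. c * (norm x)\<^sup>2 \<le> inner x (B *v x)" and c: "c \<ge> 0"
  shows "c * norm A \<le> inner A B"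
proof -
  obtain u :: "'m \<Rightarrow> complex^'m" where u: "A = (\<Sum>i\<in>UNIV. outer (u i))" by (rule psd_decomp[OF A])
  have "c * norm A \<le> c * (\<Sum>i\<in>UNIV. norm (outer (u i)))"
    unfolding u using c by (intro mult_left_mono norm_sum)
  also have "\<dots> \<le> (\<Sum>i\<in>UNIV. inner (u i) (B *v u i))"
    using B by (simp add: norm_outer sum_distrib_left sum_mono)
  also have "\<dots> = inner A B"
    unfolding u inner_sum_left by (intro sum.cong refl) (metis inner_outer inner_commute)
  finally show ?thesis .
qed

section \<open>Inverses, sandwich positivity and coercivity\<close>

lemma matrix_inv:
  fixes A :: "'a::semiring_1^'n^'m"
  assumes "invertible A"
  shows "A ** matrix_inv A = mat 1" and "matrix_inv A ** A = mat 1"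
  using someI_ex[OF assms[unfolded invertible_def]] unfolding matrix_inv_def by simp_all

lemma matrix_inv_unique:
  fixes A :: "'a::semiring_1^'n^'m"
  assumes "A ** B = mat 1" and "B ** A = mat 1"
  shows "matrix_inv A = B"
proof -
  have "invertible A" using assms invertible_def by blast
  then show ?thesis
    using assms by (metis matrix_inv(2) matrix_mul_assoc matrix_mul_lid matrix_mul_rid)
qed

lemma accretive_invertible:
  fixes A :: "complex^'m^'m"
  assumes "\<And>x. x \<noteq> 0 \<Longrightarrow> 0 < inner x (A *v x)"
  shows "invertible A"
proof -
  have "A *v x = 0 \<Longrightarrow> x = 0" for x using assms[of x] by force
  then show ?thesis
    using matrix_left_invertible_ker invertible_left_inverse by blast
qed

lemma posdef_invertible: "posdef A \<Longrightarrow> invertible A"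
  using accretive_invertible unfolding posdef_iff by blast

lemma psd_invertible_imp_posdef: "psd A \<Longrightarrow> B ** A = mat 1 \<Longrightarrow> posdef A"
  using psd_form_zero unfolding posdef_iff psd_def
  by (metis matrix_vector_mul_assoc matrix_vector_mul_lid matrix_vector_linear_simps(8) order_le_less)

lemma posdef_inverse:
  assumes A: "posdef A"
  shows "posdef (matrix_inv A)"
proof -
  let ?B = "matrix_inv A"
  have AB: "A ** ?B = mat 1" and BA: "?B ** A = mat 1"
    using matrix_inv[OF posdef_invertible[OF A]] by auto
  have hA: "ctranspose A = A" using A by (simp add: posdef_iff hermitian_def)
  have "ctranspose ?B ** A = mat 1"
    using AB by (metis ctranspose_mult ctranspose_mat1 hA)
  then have h: "ctranspose ?B = ?B"
    by (metis AB matrix_mul_assoc matrix_mul_lid matrix_mul_rid)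
  have "psd ?B" unfolding psd_def hermitian_def
  proof (intro conjI allI)
    fix x
    have x: "x = A *v (?B *v x)" by (simp add: matrix_vector_mul_assoc AB)
    have "inner x (?B *v x) = inner (?B *v x) (A *v (?B *v x))"
      using x by (metis inner_commute)
    also have "\<dots> \<ge> 0" using posdef_imp_psd[OF A] by (simp add: psd_def)
    finally show "0 \<le> inner x (?B *v x)" .
  qed (rule h)
  then show ?thesis using AB psd_invertible_imp_posdef by blast
qed

text \<open>Decomposing \<open>Z\<close> into rank-one matrices, the pairing is the sum of the forms
  of \<open>Y\<close> at the vectors \<open>D *v u i\<close>. If it vanished, \<open>D\<close> would
  kill every \<open>u i\<close>, so \<open>D ** Z = 0\<close>, and \<open>D = 0\<close> since
  \<open>Z\<close> is invertible.\<close>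

lemma posdef_sandwich:
  fixes D :: "complex^'m^'m"
  assumes Y: "posdef Y" and Z: "posdef Z" and D: "D \<noteq> 0"
  shows "0 < inner D (Y ** D ** Z)"
proof -
  obtain u :: "'m \<Rightarrow> complex^'m" where u: "Z = (\<Sum>i\<in>UNIV. outer (u i))" by (rule psd_decomp[OF posdef_imp_psd[OF Z]])
  have sum_r: "M ** (\<Sum>i\<in>UNIV. outer (u i)) = (\<Sum>i\<in>UNIV. M ** outer (u i))" for M :: "complex^'m^'m"
  proof -
    have "linear (\<lambda>B. M ** B)"
      by (auto simp: linear_iff matrix_matrix_mult_def vec_eq_iff algebra_simps sum.distrib scaleR_sum_right)
    then show ?thesis by (rule linear_sum)
  qed
  have eq: "inner D (Y ** D ** Z) = (\<Sum>i\<in>UNIV. inner (D *v u i) (Y *v (D *v u i)))"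
    unfolding u sum_r by (simp add: inner_sum_right inner_outer_mult matrix_vector_mul_assoc)
  have nn: "0 \<le> inner (D *v u i) (Y *v (D *v u i))" for i
    using posdef_imp_psd[OF Y] by (simp add: psd_def)
  show ?thesis
  proof (rule ccontr)
    assume "\<not> ?thesis"
    moreover have "0 \<le> (\<Sum>i\<in>UNIV. inner (D *v u i) (Y *v (D *v u i)))"
      by (intro sum_nonneg nn)
    ultimately have "(\<Sum>i\<in>UNIV. inner (D *v u i) (Y *v (D *v u i))) = 0"
      unfolding eq by linarith
    then have "inner (D *v u i) (Y *v (D *v u i)) = 0" for i
      using nn by (simp add: sum_nonneg_eq_0_iff)
    then have "D *v u i = 0" for i
      using Y unfolding posdef_iff by (metis less_irrefl)
    then have "D ** outer (u i) = 0" for i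
      using inner_outer_mult[of "D ** outer (u i)" D "u i"] by simp
    then have "D ** Z = 0" unfolding u sum_r by simp
    moreover have "0 ** matrix_inv Z = (0 :: complex^'m^'m)"
      by (simp add: matrix_matrix_mult_def vec_eq_iff)
    ultimately have "D ** Z ** matrix_inv Z = 0" by (simp only:)
    then have "D ** (Z ** matrix_inv Z) = 0"
      by (simp only: matrix_mul_assoc)
    then show False using D matrix_inv[OF posdef_invertible[OF Z]] by simp
  qed
qed

text \<open>By homogeneity \<open>c\<close> can be taken as the minimum of the form on the compact
  unit sphere.\<close>

lemma accretive_coercive:
  fixes A :: "complex^'m^'m"
  assumes "\<And>x. x \<noteq> 0 \<Longrightarrow> 0 < inner x (A *v x)"
  obtains c where "c > 0" "\<And>x. c * (norm x)\<^sup>2 \<le> inner x (A *v x)"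
proof -
  have cont: "continuous_on (sphere 0 1) (\<lambda>x. inner x (A *v x))"
    by (intro continuous_intros bounded_linear.continuous_on[OF bounded_bilinear.bounded_linear_right[OF bounded_bilinear_matrix_vector]])
  obtain x0 :: "complex^'m" where x0: "x0 \<in> sphere 0 1" "\<And>y. y \<in> sphere 0 1 \<Longrightarrow> inner x0 (A *v x0) \<le> inner y (A *v y)"
    using continuous_attains_inf[OF compact_sphere _ cont] by auto
  show ?thesis
  proof
    show "0 < inner x0 (A *v x0)" using x0(1) by (intro assms) auto
    show "inner x0 (A *v x0) * (norm x)\<^sup>2 \<le> inner x (A *v x)" for x
    proof (cases "x = 0")
      case False
      then have "inner x0 (A *v x0) \<le> inner (x /\<^sub>R norm x) (A *v (x /\<^sub>R norm x))"
        by (intro x0) simp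
      then show ?thesis using False by (simp add: matrix_vector_linear_simps power2_eq_square field_simps)
    qed (simp add: matrix_vector_linear_simps)
  qed
qed

text \<open>A perturbation of norm below \<open>c / K\<close> changes the form at \<open>x\<close>
  by less than \<open>c * (norm x)\<^sup>2\<close>, which the coercivity of \<open>A\<close>
  absorbs.\<close>

lemma open_accretive: "open {A :: complex^'m^'m. \<forall>x. x \<noteq> 0 \<longrightarrow> 0 < inner x (A *v x)}"
  unfolding open_dist
proof (intro ballI)
  obtain K where K: "K > 0" "\<And>(A::complex^'m^'m) x. norm (A *v x) \<le> norm A * norm x * K"
    using bounded_bilinear.pos_bounded[OF bounded_bilinear_matrix_vector] by blast
  fix A :: "complex^'m^'m"
  assume A: "A \<in> {A. \<forall>x. x \<noteq> 0 \<longrightarrow> 0 < inner x (A *v x)}"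
  then obtain c where c: "c > 0" "\<And>x. c * (norm x)\<^sup>2 \<le> inner x (A *v x)"
    using accretive_coercive[of A] by blast
  show "\<exists>e>0. \<forall>B. dist B A < e \<longrightarrow> B \<in> {A. \<forall>x. x \<noteq> 0 \<longrightarrow> 0 < inner x (A *v x)}"
  proof (intro exI[of _ "c / K"] conjI allI impI CollectI)
    show "0 < c / K" using c K by simp
    fix B and x :: "complex^'m" assume B: "dist B A < c / K" and x: "x \<noteq> 0"
    have "\<bar>inner x ((B - A) *v x)\<bar> \<le> norm x * norm ((B - A) *v x)" by (rule Cauchy_Schwarz_ineq2)
    also have "\<dots> \<le> norm x * (norm (B - A) * norm x * K)" using K by (intro mult_left_mono) auto
    also have "\<dots> = (norm (B - A) * K) * (norm x)\<^sup>2" by (simp add: power2_eq_square)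
    also have "\<dots> < c * (norm x)\<^sup>2"
      using B x K by (intro mult_strict_right_mono) (auto simp: dist_norm field_simps)
    also have "\<dots> \<le> inner x (A *v x)" by (rule c)
    finally show "0 < inner x (B *v x)" by (simp add: matrix_vector_linear_simps inner_diff_right)
  qed
qed

section \<open>Matrix-valued functions on a finite set\<close>

definition pmult :: "complex^'m^'m^'g \<Rightarrow> complex^'m^'m^'g \<Rightarrow> complex^'m^'m^'g" where
  "pmult X Y = (\<chi> a. X $ a ** Y $ a)"

definition pone :: "complex^'m^'m^'g" where
  "pone = (\<chi> a. mat 1)"

definition pinv :: "complex^'m^'m^'g \<Rightarrow> complex^'m^'m^'g" where
  "pinv X = (\<chi> a. matrix_inv (X $ a))"

text \<open>Hermitian symmetry is left out so that the set is open in the full Euclidean space,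
  where unrestricted derivatives and the inverse function theorem apply. Its Hermitian members are
  exactly \<open>posdef_functions\<close>.\<close>

definition accretive :: "(complex^'m^'m^'g) set" where
  "accretive = {X. \<forall>a. X $ a \<in> {A. \<forall>x. x \<noteq> 0 \<longrightarrow> 0 < inner x (A *v x)}}"

lemma bounded_bilinear_pmult:
  "bounded_bilinear (pmult :: complex^'m^'m^'g::finite \<Rightarrow> _)"
proof -
  have "bilinear (pmult :: complex^'m^'m^'g \<Rightarrow> _)"
    by (auto simp: bilinear_def linear_iff pmult_def matrix_matrix_mult_def vec_eq_iff
        algebra_simps sum.distrib scaleR_sum_right)
  then show ?thesis by (simp add: bilinear_conv_bounded_bilinear)
qed

global_interpretation pw: unital_bilinear "pmult :: complex^'m^'m^'g::finite \<Rightarrow> _" pone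
  by (rule unital_bilinear.intro[OF bounded_bilinear_pmult], unfold_locales)
    (simp_all add: pmult_def pone_def matrix_mul_assoc vec_eq_iff)

lemma open_accretive_functions: "open (accretive :: (complex^'m^'m^'g) set)"
  unfolding accretive_def by (intro open_vector_box open_accretive allI)

lemma posdef_functions_eq: "posdef_functions = herm_functions \<inter> accretive"
  by (auto simp: posdef_functions_def herm_functions_def accretive_def posdef_iff)

lemma pinv_accretive:
  assumes "X \<in> accretive"
  shows "pmult X (pinv X) = pone" and "pmult (pinv X) X = pone"
proof -
  have "invertible (X $ a)" for a
    using assms by (intro accretive_invertible) (simp add: accretive_def)
  then show "pmult X (pinv X) = pone" and "pmult (pinv X) X = pone"
    by (simp_all add: pmult_def pone_def pinv_def vec_eq_iff matrix_inv)
qed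

lemma pinv_unique:
  fixes X Y :: "complex^'m^'m^'g"
  shows "pmult X Y = pone \<Longrightarrow> pmult Y X = pone \<Longrightarrow> pinv X = Y"
  by (simp add: pmult_def pone_def pinv_def vec_eq_iff[where 'b = 'g] matrix_inv_unique)

lemma posdef_functions_accretive: "X \<in> posdef_functions \<Longrightarrow> X \<in> accretive"
  by (simp add: posdef_functions_eq)

lemma pinv_posdef: "X \<in> posdef_functions \<Longrightarrow> pinv X \<in> posdef_functions"
  by (simp add: posdef_functions_def pinv_def posdef_inverse)

lemma pinv_pinv: "X \<in> posdef_functions \<Longrightarrow> pinv (pinv X) = X"
  by (intro pinv_unique pinv_accretive posdef_functions_accretive)

lemma subspace_hermitian: "subspace {A :: complex^'m^'m. hermitian A}"
  by (auto simp: subspace_def hermitian_def ctranspose_def vec_eq_iff)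

lemma subspace_herm_functions: "subspace (herm_functions :: (complex^'m^'m^'g) set)"
  using subspace_hermitian[where 'm = 'm] by (auto simp: subspace_def herm_functions_def)

lemma closed_herm_functions: "closed (herm_functions :: (complex^'m^'m^'g::finite) set)"
  by (rule closed_subspace[OF subspace_herm_functions])

text \<open>Hermitian directions preserve symmetry, and openness of \<open>accretive\<close>
  preserves positivity for small steps.\<close>

lemma relatively_open_posdef:
  "relatively_open herm_functions (posdef_functions :: (complex^'m^'m^'g) set)"
proof
  fix x v :: "complex^'m^'m^'g"
  assume x: "x \<in> posdef_functions" and v: "v \<in> herm_functions"
  have "open ((\<lambda>t::real. x + t *\<^sub>R v) -` accretive)"
    by (intro open_vimage open_accretive_functions continuous_intros)
  moreover have "0 \<in> (\<lambda>t::real. x + t *\<^sub>R v) -` accretive"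
    using x by (simp add: posdef_functions_eq)
  ultimately obtain d where d: "d > 0" "ball 0 d \<subseteq> (\<lambda>t::real. x + t *\<^sub>R v) -` accretive"
    using open_contains_ball by blast
  moreover have "x + t *\<^sub>R v \<in> herm_functions" for t
    using x v by (intro subspace_add subspace_scale subspace_herm_functions) (simp_all add: posdef_functions_eq)
  ultimately show "\<exists>d>0. \<forall>t. \<bar>t\<bar> < d \<longrightarrow> x + t *\<^sub>R v \<in> posdef_functions"
    by (intro exI[of _ d]) (auto simp: posdef_functions_eq subset_iff)
qed

global_interpretation herm: relatively_open herm_functions "posdef_functions :: (complex^'m^'m^'g::finite) set"
  by (rule relatively_open_posdef)

lemma pinv_has_derivative:
  assumes "X \<in> accretive"
  shows "(pinv has_derivative (\<lambda>v. - pmult (pinv X) (pmult v (pinv X)))) (at X)"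
  using pw.has_derivative_inverse[of "\<lambda>x. x" "\<lambda>x. x" X accretive pinv] assms
  by (simp add: pinv_accretive at_within_open[OF _ open_accretive_functions])

lemma continuous_on_pinv: "continuous_on accretive pinv"
  using pinv_has_derivative has_derivative_continuous continuous_at_imp_continuous_on by blast

text \<open>At every point the pairing is the trace of the identity. That it does not depend on
  \<open>X\<close> makes the bound in \<open>sol_bound\<close> independent of the solution.\<close>

lemma inner_pinv:
  fixes X :: "complex^'m^'m^'g"
  assumes "X \<in> posdef_functions"
  shows "inner X (pinv X) = inner (pone :: complex^'m^'m^'g) pone"
proof -
  have "inner (X $ a) (pinv X $ a) = inner (mat 1 :: complex^'m^'m) (mat 1)" for a
  proof -
    have "posdef (X $ a)" using assms by (simp add: posdef_functions_def)
    then have "ctranspose (matrix_inv (X $ a)) = matrix_inv (X $ a)" "X $ a ** matrix_inv (X $ a) = mat 1"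
      using posdef_inverse[of "X $ a"] matrix_inv(1)[OF posdef_invertible, of "X $ a"]
      by (simp_all add: posdef_iff hermitian_def)
    then show ?thesis
      using inner_mul_right[of "X $ a" "mat 1" "matrix_inv (X $ a)"] by (simp add: pinv_def)
  qed
  then show ?thesis by (simp add: inner_vec_def[where 'b = 'g] pone_def)
qed

lemma inner_sandwich_pos:
  assumes Y: "Y \<in> posdef_functions" and Z: "Z \<in> posdef_functions" and D: "D \<noteq> 0"
  shows "0 < inner D (pmult (pmult Y D) Z)"
proof -
  obtain a where a: "D $ a \<noteq> 0" using D by (auto simp: vec_eq_iff)
  have pos: "0 < inner (D $ b) (Y $ b ** D $ b ** Z $ b)" if "D $ b \<noteq> 0" for b
    using Y Z that by (intro posdef_sandwich) (auto simp: posdef_functions_def)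
  then have "0 \<le> inner (D $ b) (Y $ b ** D $ b ** Z $ b)" for b
    by (cases "D $ b = 0") (auto intro: less_imp_le)
  then have "0 < (\<Sum>b\<in>UNIV. inner (D $ b) (Y $ b ** D $ b ** Z $ b))"
    using pos[OF a] by (intro sum_pos2[of _ a]) auto
  then show ?thesis by (simp add: inner_vec_def[of D] pmult_def)
qed

lemma posdef_functions_coercive:
  fixes B :: "complex^'m^'m^'g"
  assumes "B \<in> posdef_functions"
  obtains c where "c > 0" "\<And>a x. c * (norm x)\<^sup>2 \<le> inner x (B $ a *v x)"
proof -
  have "\<exists>c>0. \<forall>x. c * (norm x)\<^sup>2 \<le> inner x (B $ a *v x)" for a
    using accretive_coercive[of "B $ a"] assms
    by (metis (mono_tags, lifting) posdef_functions_def posdef_iff mem_Collect_eq)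
  then obtain c where c: "\<And>a. c a > 0" "\<And>a x. c a * (norm x)\<^sup>2 \<le> inner x (B $ a *v x)"
    by metis
  show ?thesis
  proof
    show "0 < Min (range c)" using c(1) by auto
    show "Min (range c) * (norm x)\<^sup>2 \<le> inner x (B $ a *v x)" for a x
      using c(2)[of a x] by (rule order_trans[rotated]) (auto intro!: mult_right_mono)
  qed
qed

lemma posdef_inner_ge:
  fixes X B :: "complex^'m^'m^'g"
  assumes X: "X \<in> posdef_functions" and B: "\<And>a x. c * (norm x)\<^sup>2 \<le> inner x (B $ a *v x)" and c: "c \<ge> 0"
  shows "c * norm X \<le> inner X B"
proof -
  have "norm X \<le> (\<Sum>a\<in>UNIV. norm (X $ a))"
    unfolding norm_vec_def[of X] by (rule L2_set_le_sum) simp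
  then have "c * norm X \<le> (\<Sum>a\<in>UNIV. c * norm (X $ a))"
    using c by (simp add: mult_left_mono flip: sum_distrib_left)
  also have "\<dots> \<le> (\<Sum>a\<in>UNIV. inner (X $ a) (B $ a))"
    using X B c by (intro sum_mono psd_inner_ge posdef_imp_psd) (auto simp: posdef_functions_def)
  finally show ?thesis by (simp add: inner_vec_def[of X])
qed

section \<open>The affine inverse problem\<close>

lemma orthogonal_projection_exists:
  fixes L :: "'a::euclidean_space set"
  assumes "subspace L"
  obtains p where "linear p" "\<And>x. p x \<in> L" "\<And>x l. l \<in> L \<Longrightarrow> inner (x - p x) l = 0"
proof -
  obtain B where B: "B \<subseteq> L" "pairwise orthogonal B" "\<And>x. x \<in> B \<Longrightarrow> norm x = 1" "independent B" "span B = L"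
    using orthonormal_basis_subspace[OF assms] by metis
  have fin: "finite B" using B(4) independent_imp_finite by blast
  define p where "p x = (\<Sum>b\<in>B. inner x b *\<^sub>R b)" for x
  show ?thesis
  proof
    show "linear p"
      by (auto simp: p_def linear_iff inner_add_left scaleR_add_left sum.distrib scaleR_sum_right)
    show "p x \<in> L" for x
      unfolding p_def using B(1) assms by (intro subspace_sum subspace_scale) auto
    show "inner (x - p x) l = 0" if "l \<in> L" for x l
    proof -
      have "inner (p x) b = inner x b" if b: "b \<in> B" for b
      proof -
        have "inner (p x) b = (\<Sum>c\<in>B. if c = b then inner x b else 0)"
          unfolding p_def inner_sum_left using B(2,3) b
          by (intro sum.cong refl) (auto simp: pairwise_def orthogonal_def norm_eq_1)
        then show ?thesis using fin b by simp
      qed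
      then have "\<forall>b\<in>B. orthogonal (x - p x) b"
        by (simp add: orthogonal_def inner_diff_left)
      then show ?thesis
        using orthogonal_to_span[of l B "x - p x"] that B(5) by (simp add: orthogonal_def)
    qed
  qed
qed

text \<open>The problem stripped of characters: there remain a subspace of Hermitian functions, its
  orthogonal projection, and one positive definite function carrying the moment data.\<close>

locale affine_inverse_problem =
  fixes L :: "(complex^'m^'m^'g) set" and p :: "complex^'m^'m^'g \<Rightarrow> complex^'m^'m^'g"
    and \<Phi> :: "complex^'m^'m^'g"
  assumes subspace_L: "subspace L" and L_herm: "L \<subseteq> herm_functions"
    and linear_p: "linear p" and p_in: "p x \<in> L" and p_orth: "l \<in> L \<Longrightarrow> inner (x - p x) l = 0"
    and \<Phi>_posdef: "\<Phi> \<in> posdef_functions"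
begin

definition sol :: "complex^'m^'m^'g \<Rightarrow> complex^'m^'m^'g \<Rightarrow> bool" where
  "sol A X \<longleftrightarrow> X \<in> posdef_functions \<and> X - A \<in> L \<and> (\<forall>l\<in>L. inner (pinv X - \<Phi>) l = 0)"

definition G :: "complex^'m^'m^'g \<Rightarrow> complex^'m^'m^'g" where
  "G X = p (pinv X) + (X - p X)"

definition target :: "complex^'m^'m^'g \<Rightarrow> complex^'m^'m^'g" where
  "target A = p \<Phi> + (A - p A)"

text \<open>The derivative of \<open>G\<close> at \<open>X\<close>, written in terms of
  \<open>Y = pinv X\<close>. As an element of the normed space of bounded linear maps it depends
  polynomially on \<open>Y\<close>, so regularity of \<open>Y\<close> is inherited.\<close>

definition DG :: "complex^'m^'m^'g \<Rightarrow> (complex^'m^'m^'g) \<Rightarrow>\<^sub>L (complex^'m^'m^'g)" where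
  "DG Y = id_blinfun - Blinfun p - (Blinfun p o\<^sub>L (pw.prod_right Y o\<^sub>L pw.prod_left Y))"

lemma bounded_linear_p: "bounded_linear p"
  using linear_p by (rule linear_conv_bounded_linear[THEN iffD1])

lemmas p_simps = linear_add[OF linear_p] linear_diff[OF linear_p] linear_neg[OF linear_p]

lemma p_fixes: "l \<in> L \<Longrightarrow> p l = l"
  using p_orth[of "l - p l" l] p_in subspace_L subspace_diff by fastforce

lemma p_eq_0_iff: "p x = 0 \<longleftrightarrow> (\<forall>l\<in>L. inner x l = 0)"
proof
  assume "p x = 0"
  then show "\<forall>l\<in>L. inner x l = 0" using p_orth[of _ x] by simp
next
  assume "\<forall>l\<in>L. inner x l = 0"
  then have "inner (p x) (p x) = 0"
    using p_in p_orth[OF p_in, of x x] by (simp add: inner_diff_left)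
  then show "p x = 0" by simp
qed

text \<open>The two linear conditions take values in \<open>L\<close> and in its orthogonal
  complement. Their sum is therefore one equation without loss, and applying \<open>p\<close>
  separates them again.\<close>

lemma sol_iff: "sol A X \<longleftrightarrow> X \<in> posdef_functions \<and> G X = target A"
proof -
  have "X - A \<in> L \<and> p (pinv X - \<Phi>) = 0 \<longleftrightarrow> G X = target A" (is "?l \<longleftrightarrow> ?r")
  proof
    assume ?l
    then show ?r using p_fixes[of "X - A"] by (simp add: G_def target_def p_simps algebra_simps)
  next
    assume ?r
    moreover have "p (G X) = p (pinv X)" "p (target A) = p \<Phi>"
      by (simp_all add: G_def target_def p_simps p_fixes p_in)
    ultimately have 1: "p (pinv X) = p \<Phi>" by simp
    then have "X - A = p (X - A)" using \<open>?r\<close> by (simp add: G_def target_def p_simps algebra_simps)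
    then show ?l using p_in 1 by (metis p_simps(2) right_minus_eq)
  qed
  then show ?thesis unfolding sol_def p_eq_0_iff by blast
qed

text \<open>The difference of two solutions lies in \<open>L\<close> and is orthogonal to the
  difference of their inverses. By the resolvent identity the latter is minus a sandwich of the
  former, which contradicts \<open>inner_sandwich_pos\<close>.\<close>

lemma sol_unique:
  assumes "sol A X" and "sol A X'"
  shows "X = X'"
proof (rule ccontr)
  assume "X \<noteq> X'"
  let ?D = "X - X'"
  have P: "X \<in> posdef_functions" "X' \<in> posdef_functions" using assms by (auto simp: sol_def)
  have D: "?D \<in> L" using assms subspace_diff[OF subspace_L, of "X - A" "X' - A"] by (simp add: sol_def)
  have "pinv X - pinv X' = - pmult (pinv X) (pmult ?D (pinv X'))"
    using P by (intro pw.inverse_diff pinv_accretive posdef_functions_accretive)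
  moreover have "inner (pinv X - pinv X') ?D = 0"
    using assms D by (auto simp: sol_def inner_diff_left)
  ultimately have "inner ?D (pmult (pmult (pinv X) ?D) (pinv X')) = 0"
    by (simp add: pw.assoc inner_commute)
  moreover have "0 < inner ?D (pmult (pmult (pinv X) ?D) (pinv X'))"
    using P \<open>X \<noteq> X'\<close> by (intro inner_sandwich_pos pinv_posdef) auto
  ultimately show False by simp
qed

text \<open>The constraints say that \<open>X - A\<close> is orthogonal to \<open>pinv X - \<Phi>\<close>.\<close>

lemma sol_bound:
  assumes sol: "sol A X" and c: "c \<ge> 0"
    and A: "\<And>a x. c * (norm x)\<^sup>2 \<le> inner x (A $ a *v x)"
    and \<Phi>: "\<And>a x. c * (norm x)\<^sup>2 \<le> inner x (\<Phi> $ a *v x)"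
  shows "c * (norm X + norm (pinv X)) \<le> inner (pone :: complex^'m^'m^'g) pone + inner A \<Phi>"
proof -
  have P: "X \<in> posdef_functions" using sol by (simp add: sol_def)
  have "inner (pinv X - \<Phi>) (X - A) = 0" using sol by (simp add: sol_def)
  \<comment> \<open>Expanding the orthogonality leaves the two terms to be bounded on the left; on
    the right only \<open>inner X (pinv X)\<close> contains \<open>X\<close>, and it is
    constant.\<close>
  then have "inner X \<Phi> + inner (pinv X) A = inner X (pinv X) + inner A \<Phi>"
    by (simp add: inner_diff_left inner_diff_right inner_commute algebra_simps)
  moreover have "c * norm X \<le> inner X \<Phi>" by (rule posdef_inner_ge[OF P \<Phi> c])
  moreover have "c * norm (pinv X) \<le> inner (pinv X) A" by (rule posdef_inner_ge[OF pinv_posdef[OF P] A c])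
  ultimately show ?thesis using inner_pinv[OF P] by (simp add: algebra_simps)
qed

lemma DG_apply: "blinfun_apply (DG Y) h = h - p h - p (pmult Y (pmult h Y))"
  by (simp add: DG_def blinfun.diff_left bounded_linear_Blinfun_apply[OF bounded_linear_p])

text \<open>A kernel element is a sum of values of \<open>p\<close>, hence in \<open>L\<close> and
  fixed by \<open>p\<close>. What remains says that \<open>h\<close> is orthogonal to its own
  sandwich by \<open>Y\<close>.\<close>

lemma DG_injective:
  assumes Y: "Y \<in> posdef_functions" and h: "blinfun_apply (DG Y) h = 0"
  shows "h = 0"
proof (rule ccontr)
  assume "h \<noteq> 0"
  have "h = p h + p (pmult Y (pmult h Y))" using h by (simp add: DG_apply algebra_simps)
  then have hL: "h \<in> L" using p_in subspace_add[OF subspace_L] by metis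
  then have "p (pmult Y (pmult h Y)) = 0" using h p_fixes by (simp add: DG_apply)
  then have "inner (pmult Y (pmult h Y)) h = 0" using hL p_eq_0_iff by blast
  then show False
    using inner_sandwich_pos[OF Y Y \<open>h \<noteq> 0\<close>] by (simp add: pw.assoc inner_commute)
qed

lemma DG_inverse:
  assumes Y: "Y \<in> posdef_functions"
  obtains R where "R o\<^sub>L DG Y = id_blinfun" "DG Y o\<^sub>L R = id_blinfun"
proof -
  have lin: "linear (blinfun_apply (DG Y))"
    using blinfun.bounded_linear_right linear_conv_bounded_linear by blast
  have "inj (blinfun_apply (DG Y))"
    using DG_injective[OF Y] linear_injective_0[OF lin] by blast
  from linear_injective_isomorphism[OF lin this]
  obtain f' where f': "linear f'" "\<And>x. f' (blinfun_apply (DG Y) x) = x" "\<And>x. blinfun_apply (DG Y) (f' x) = x"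
    by blast
  have "blinfun_apply (Blinfun f') = f'"
    using f'(1) by (intro bounded_linear_Blinfun_apply) (simp add: linear_conv_bounded_linear)
  then show ?thesis
    using f' by (intro that[of "Blinfun f'"] blinfun_eqI) simp_all
qed

lemma G_has_derivative:
  assumes "X \<in> accretive"
  shows "(G has_derivative blinfun_apply (DG (pinv X))) (at X)"
proof -
  have "(G has_derivative (\<lambda>h. p (- pmult (pinv X) (pmult h (pinv X))) + (h - p h))) (at X)"
    unfolding G_def
    by (intro has_derivative_add has_derivative_diff has_derivative_ident
        bounded_linear.has_derivative[OF bounded_linear_p] pinv_has_derivative assms)
  then show ?thesis by (simp add: DG_apply[abs_def] p_simps algebra_simps)
qed

lemma continuous_on_DG: "continuous_on accretive (\<lambda>X. DG (pinv X))"
  unfolding DG_def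
  by (intro continuous_intros continuous_on_pinv bounded_linear.continuous_on[OF pw.bounded_linear_prod_right]
      bounded_linear.continuous_on[OF pw.bounded_linear_prod_left]
      bounded_bilinear.continuous_on[OF bounded_bilinear_blinfun_compose])

text \<open>The inverse function theorem is applied on \<open>accretive\<close>, an open set of the
  full space. What it leaves open is that the local inverse sends Hermitian functions to positive
  definite ones.\<close>

lemma G_local_inverse:
  assumes X0: "X0 \<in> posdef_functions"
  obtains V g g' where "open V" "G X0 \<in> V" "g (G X0) = X0"
    "\<And>y. y \<in> V \<Longrightarrow> y \<in> herm_functions \<Longrightarrow> g y \<in> posdef_functions \<and> G (g y) = y"
    "(g has_derivative g') (at (G X0))" "\<And>h. blinfun_apply (DG (pinv X0)) (g' h) = h"
proof -
  have acc: "X0 \<in> accretive" using X0 by (rule posdef_functions_accretive)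
  obtain R where R: "R o\<^sub>L DG (pinv X0) = id_blinfun" "DG (pinv X0) o\<^sub>L R = id_blinfun"
    by (rule DG_inverse[OF pinv_posdef[OF X0]])
  obtain U' V g g' where U': "open U'" "U' \<subseteq> accretive" "X0 \<in> U'" and V: "open V" "G X0 \<in> V"
    and hom: "homeomorphism U' V G g"
    and g: "\<And>y. y \<in> V \<Longrightarrow> (g has_derivative (g' y)) (at y)"
    and g': "\<And>y. y \<in> V \<Longrightarrow> g' y = inv (blinfun_apply (DG (pinv (g y))))"
    and bij: "\<And>y. y \<in> V \<Longrightarrow> bij (blinfun_apply (DG (pinv (g y))))"
    by (rule inverse_function_theorem[OF open_accretive_functions G_has_derivative continuous_on_DG acc R(1)]) blast+
  show ?thesis
  proof
    show "open V" "G X0 \<in> V" by fact+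
    show gX: "g (G X0) = X0" using hom U'(3) by (simp add: homeomorphism_apply1)
    show "g y \<in> posdef_functions \<and> G (g y) = y" if y: "y \<in> V" "y \<in> herm_functions" for y
    proof -
      have "g y \<in> U'" using hom y(1) by (auto simp: homeomorphism_def)
      then have "g y \<in> accretive" using U'(2) by blast
      have Gy: "G (g y) = y" using hom y(1) by (simp add: homeomorphism_apply2)
      \<comment> \<open>Solving \<open>G (g y) = y\<close> for \<open>g y\<close> expresses it as
        \<open>y\<close> plus elements of \<open>L\<close>, and all of these are Hermitian.\<close>
      then have eq: "g y = y - p (pinv (g y)) + p (g y)"
        by (simp add: G_def algebra_simps)
      have "y - p (pinv (g y)) + p (g y) \<in> herm_functions"
        by (intro subspace_add[OF subspace_herm_functions] subspace_diff[OF subspace_herm_functions]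
            y(2) subsetD[OF L_herm p_in])
      then have "g y \<in> herm_functions" by (simp only: eq[symmetric])
      then show ?thesis using \<open>g y \<in> accretive\<close> Gy by (simp add: posdef_functions_eq)
    qed
    show "(g has_derivative g' (G X0)) (at (G X0))" using g V(2) by blast
    show "blinfun_apply (DG (pinv X0)) (g' (G X0) h) = h" for h
      using g'[OF V(2)] bij[OF V(2)] unfolding gX by (simp add: bij_is_surj surj_f_inv_f)
  qed
qed

lemma target_herm: "A \<in> herm_functions \<Longrightarrow> target A \<in> herm_functions"
  unfolding target_def
  by (intro subspace_add[OF subspace_herm_functions] subspace_diff[OF subspace_herm_functions]
      subsetD[OF L_herm p_in])

lemma continuous_on_target: "continuous_on S target"
  unfolding target_def
  by (intro continuous_intros bounded_linear.continuous_on[OF bounded_linear_p])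

lemma closed_psd: "closed {X :: complex^'m^'m^'g. \<forall>a. psd (X $ a)}"
proof -
  have "{X :: complex^'m^'m^'g. \<forall>a. psd (X $ a)}
    = herm_functions \<inter> {X. \<forall>a x. 0 \<le> inner x (X $ a *v x)}"
    by (auto simp: psd_def herm_functions_def)
  moreover have "closed {X :: complex^'m^'m^'g. \<forall>a x. 0 \<le> inner x (X $ a *v x)}"
    by (intro closed_Collect_all closed_Collect_le continuous_intros
        bounded_linear.continuous_on[OF bounded_bilinear.bounded_linear_left[OF bounded_bilinear_matrix_vector]])
  ultimately show ?thesis using closed_herm_functions by auto
qed

text \<open>Continuity method along the segment from \<open>pinv \<Phi>\<close>, for which \<open>pinv \<Phi>\<close> itself is the
  solution, to \<open>A\<close>.\<close>

lemma sol_exists: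
  assumes A: "A \<in> posdef_functions"
  shows "\<exists>X. sol A X"
proof -
  define B where "B t = (1 - t) *\<^sub>R pinv \<Phi> + t *\<^sub>R A" for t :: real
  define I where "I = {t \<in> {0..1}. \<exists>X. sol (B t) X}"
  obtain c1 where c1: "c1 > 0" "\<And>a x. c1 * (norm x)\<^sup>2 \<le> inner x (A $ a *v x)"
    by (rule posdef_functions_coercive[OF A]) blast
  obtain c2 where c2: "c2 > 0" "\<And>a x. c2 * (norm x)\<^sup>2 \<le> inner x (pinv \<Phi> $ a *v x)"
    by (rule posdef_functions_coercive[OF pinv_posdef[OF \<Phi>_posdef]]) blast
  obtain c3 where c3: "c3 > 0" "\<And>a x. c3 * (norm x)\<^sup>2 \<le> inner x (\<Phi> $ a *v x)"
    by (rule posdef_functions_coercive[OF \<Phi>_posdef]) blast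
  \<comment> \<open>A common coercivity constant: \<open>A\<close> and \<open>pinv \<Phi>\<close>
    control every convex combination \<open>B t\<close>, and \<open>\<Phi>\<close> itself enters
    \<open>sol_bound\<close>.\<close>
  define c where "c = min c1 (min c2 c3)"
  have c: "c > 0" using c1 c2 c3 by (simp add: c_def)
  have le: "c * (norm x)\<^sup>2 \<le> c1 * (norm x)\<^sup>2" "c * (norm x)\<^sup>2 \<le> c2 * (norm x)\<^sup>2"
    "c * (norm x)\<^sup>2 \<le> c3 * (norm x)\<^sup>2" for x :: "complex^'m"
    by (intro mult_right_mono; simp add: c_def)+
  have B_ge: "c * (norm x)\<^sup>2 \<le> inner x (B t $ a *v x)" if t: "t \<in> {0..1}" for t a x
  proof -
    have "c * (norm x)\<^sup>2 = (1 - t) * (c * (norm x)\<^sup>2) + t * (c * (norm x)\<^sup>2)" by (simp add: algebra_simps)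
    also have "\<dots> \<le> (1 - t) * inner x (pinv \<Phi> $ a *v x) + t * inner x (A $ a *v x)"
      using t order_trans[OF le(1) c1(2)] order_trans[OF le(2) c2(2)] by (intro add_mono mult_left_mono) auto
    also have "\<dots> = inner x (B t $ a *v x)"
      by (simp add: B_def matrix_vector_linear_simps inner_add_right)
    finally show ?thesis .
  qed
  have B_herm: "B t \<in> herm_functions" for t
    unfolding B_def using A pinv_posdef[OF \<Phi>_posdef]
    by (intro subspace_add subspace_scale subspace_herm_functions) (auto simp: posdef_functions_eq)
  have B_cont: "continuous_on S B" for S unfolding B_def by (intro continuous_intros)
  \<comment> \<open>The right side of \<open>sol_bound\<close>, made uniform in \<open>t\<close> by
    absolute values and divided by \<open>c\<close>.\<close>
  define C where "C = (inner (pone :: complex^'m^'m^'g) pone + (\<bar>inner (pinv \<Phi>) \<Phi>\<bar> + \<bar>inner A \<Phi>\<bar>)) / c"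
  have bound: "norm X \<le> C" "norm (pinv X) \<le> C" if t: "t \<in> {0..1}" and X: "sol (B t) X" for t X
  proof -
    have le_abs: "s * a \<le> \<bar>a\<bar>" if "0 \<le> s" "s \<le> 1" for s a :: real
    proof -
      have "s * a \<le> s * \<bar>a\<bar>" using that by (intro mult_left_mono) auto
      also have "\<dots> \<le> 1 * \<bar>a\<bar>" using that by (intro mult_right_mono) auto
      finally show ?thesis by simp
    qed
    have "inner (B t) \<Phi> = (1 - t) * inner (pinv \<Phi>) \<Phi> + t * inner A \<Phi>"
      by (simp add: B_def inner_add_left)
    also have "\<dots> \<le> \<bar>inner (pinv \<Phi>) \<Phi>\<bar> + \<bar>inner A \<Phi>\<bar>"
      using t by (intro add_mono le_abs) auto
    finally have "c * (norm X + norm (pinv X)) \<le> C * c"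
      using sol_bound[OF X less_imp_le[OF c] B_ge[OF t] order_trans[OF le(3) c3(2)]] c
      by (simp add: C_def)
    then have "norm X + norm (pinv X) \<le> C" using c by (simp add: mult.commute)
    then show "norm X \<le> C" "norm (pinv X) \<le> C" using norm_ge_zero[of X] norm_ge_zero[of "pinv X"] by linarith+
  qed
  \<comment> \<open>A variable \<open>Y\<close> stands for \<open>pinv X\<close>, so that all
    conditions become closed. Bounds on both \<open>X\<close> and \<open>Y\<close> give compactness,
    and the relations between them survive in the limit, where \<open>X\<close> might otherwise
    become singular.\<close>
  define K where "K = ({0..1} \<times> cball 0 C \<times> cball 0 C) \<inter>
    {(t, X, Y). pmult X Y = pone \<and> pmult Y X = pone \<and> (\<forall>a. psd (X $ a)) \<and>
      p Y + (X - p X) = target (B t)}"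
  have cont_p: "continuous_on S (\<lambda>z. p (f z))" if "continuous_on S f" for S and f :: "real \<times> (complex^'m^'m^'g) \<times> (complex^'m^'m^'g) \<Rightarrow> _"
    using that by (rule bounded_linear.continuous_on[OF bounded_linear_p])
  have "closed {z. pmult (fst (snd z)) (snd (snd z)) = pone \<and> pmult (snd (snd z)) (fst (snd z)) = pone \<and>
      fst (snd z) \<in> {X. \<forall>a. psd (X $ a)} \<and>
      p (snd (snd z)) + (fst (snd z) - p (fst (snd z))) = target (B (fst z))}"
    by (intro closed_Collect_conj closed_Collect_eq continuous_intros bounded_bilinear.continuous_on[OF bounded_bilinear_pmult]
        cont_p continuous_closed_vimage[OF closed_psd, unfolded vimage_def]
        continuous_on_compose2[OF continuous_on_target[of UNIV]] continuous_on_compose2[OF B_cont[of UNIV]]) auto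
  then have "compact K"
    unfolding K_def by (intro compact_Int_closed compact_Times) (auto simp: case_prod_unfold)
  have "I = fst ` K"
  proof (intro set_eqI iffI)
    fix t assume "t \<in> I"
    then obtain X where t: "t \<in> {0..1}" and X: "sol (B t) X" by (auto simp: I_def)
    have P: "X \<in> posdef_functions" using X by (simp add: sol_def)
    have "(t, X, pinv X) \<in> K"
      using bound[OF t X] t X P pinv_accretive[OF posdef_functions_accretive[OF P]]
      by (auto simp: K_def sol_iff G_def posdef_functions_def posdef_imp_psd)
    then show "t \<in> fst ` K" by force
  next
    fix t assume "t \<in> fst ` K"
    then obtain X Y where t: "t \<in> {0..1}" and XY: "pmult X Y = pone" "pmult Y X = pone"
      and psd: "\<forall>a. psd (X $ a)" and eq: "p Y + (X - p X) = target (B t)"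
      by (auto simp: K_def)
    \<comment> \<open>Invertibility, witnessed by \<open>Y\<close>, upgrades semidefinite back to
      definite.\<close>
    have "Y $ a ** X $ a = mat 1" for a
      using XY(2) by (metis (no_types, lifting) pmult_def pone_def vec_lambda_beta)
    then have "X \<in> posdef_functions"
      using psd psd_invertible_imp_posdef by (auto simp: posdef_functions_def)
    then have "sol (B t) X" using eq pinv_unique[OF XY] by (simp add: sol_iff G_def)
    then show "t \<in> I" using t by (auto simp: I_def)
  qed
  then have "closed I"
    using \<open>compact K\<close> by (auto intro!: compact_imp_closed compact_continuous_image continuous_intros)
  then have cl: "closedin (top_of_set {0..1}) I"
    by (auto simp: I_def intro: closed_subset)
  \<comment> \<open>Near a solvable parameter the local inverse of \<open>G\<close> produces
    solutions, since the targets stay Hermitian and vary continuously.\<close>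
  have op: "openin (top_of_set {0..1}) I"
    unfolding openin_subopen[of _ I]
  proof
    fix t assume "t \<in> I"
    then obtain X where t: "t \<in> {0..1}" and X: "sol (B t) X" by (auto simp: I_def)
    then have P: "X \<in> posdef_functions" and GX: "G X = target (B t)" by (simp_all add: sol_iff)
    obtain V g g' where V: "open V" "G X \<in> V"
      "\<And>y. y \<in> V \<Longrightarrow> y \<in> herm_functions \<Longrightarrow> g y \<in> posdef_functions \<and> G (g y) = y"
      by (rule G_local_inverse[OF P]) blast
    let ?T = "{0..1} \<inter> (\<lambda>t. target (B t)) -` V"
    have "open ((\<lambda>t. target (B t)) -` V)"
      using V(1) by (rule open_vimage)
        (rule continuous_on_compose2[OF continuous_on_target[of UNIV] B_cont], simp)
    then have "openin (top_of_set {0..1}) ?T" by blast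
    moreover have "t \<in> ?T" using t V(2) GX by simp
    moreover have "?T \<subseteq> I"
      using V(3)[OF _ target_herm[OF B_herm]] by (auto simp: I_def sol_iff)
    ultimately show "\<exists>T. openin (top_of_set {0..1}) T \<and> t \<in> T \<and> T \<subseteq> I" by blast
  qed
  have "sol (B 0) (pinv \<Phi>)"
    using pinv_posdef[OF \<Phi>_posdef] pinv_pinv[OF \<Phi>_posdef] subspace_0[OF subspace_L]
    by (simp add: sol_def B_def)
  then have "0 \<in> I" by (auto simp: I_def)
  moreover have "connected {0..1::real}" by simp
  ultimately have "I = {0..1}"
    using cl op unfolding connected_clopen by blast
  then have "1 \<in> I" by simp
  then show ?thesis by (auto simp: I_def B_def)
qed

section \<open>Smooth dependence of the solution on the data\<close>

definition solution :: "complex^'m^'m^'g \<Rightarrow> complex^'m^'m^'g" where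
  "solution A = (THE X. sol A X)"

lemma sol_solution: "A \<in> posdef_functions \<Longrightarrow> sol A (solution A)"
  unfolding solution_def using sol_exists sol_unique by (metis theI')

lemma solution_eqI: "sol A X \<Longrightarrow> solution A = X"
  unfolding solution_def using sol_unique by blast

text \<open>By uniqueness the solution coincides near \<open>\<Psi>\<close> with a local inverse of
  \<open>G\<close> applied to \<open>target (pinv \<Psi>)\<close>, so the chain rule
  applies.\<close>

lemma solution_has_derivative:
  assumes \<Psi>: "\<Psi> \<in> posdef_functions"
    and R: "R o\<^sub>L DG (pinv (solution (pinv \<Psi>))) = id_blinfun"
  defines "D v \<equiv> - pmult (pinv \<Psi>) (pmult v (pinv \<Psi>))"
  shows "((\<lambda>\<Psi>. solution (pinv \<Psi>)) has_derivative (\<lambda>v. blinfun_apply R (D v - p (D v))))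
    (at \<Psi> within posdef_functions)"
proof -
  let ?X = "solution (pinv \<Psi>)" and ?y = "\<lambda>\<Psi>. target (pinv \<Psi>)"
  have X: "?X \<in> posdef_functions" "G ?X = ?y \<Psi>"
    using sol_solution[OF pinv_posdef[OF \<Psi>]] by (simp_all add: sol_iff)
  obtain V g g' where V: "open V" "G ?X \<in> V" and gX: "g (G ?X) = ?X"
    and g: "\<And>y. y \<in> V \<Longrightarrow> y \<in> herm_functions \<Longrightarrow> g y \<in> posdef_functions \<and> G (g y) = y"
    and g': "(g has_derivative g') (at (G ?X))" "\<And>h. blinfun_apply (DG (pinv ?X)) (g' h) = h"
    by (rule G_local_inverse[OF X(1)]) blast
  \<comment> \<open>A left inverse and a right inverse of the same map coincide.\<close>
  have g'R: "g' h = blinfun_apply R h" for h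
    using g'(2)[of h] R by (metis blinfun_apply_blinfun_compose blinfun_apply_id_blinfun)
  have "(pinv has_derivative D) (at \<Psi> within posdef_functions)"
    using has_derivative_at_withinI[OF pinv_has_derivative[OF posdef_functions_accretive[OF \<Psi>]]]
    unfolding D_def[abs_def] .
  then have y: "(?y has_derivative (\<lambda>v. 0 + (D v - p (D v)))) (at \<Psi> within posdef_functions)"
    unfolding target_def
    by (intro has_derivative_add has_derivative_const has_derivative_diff
        bounded_linear.has_derivative[OF bounded_linear_p])
  have "((\<lambda>\<Psi>. g (?y \<Psi>)) has_derivative (\<lambda>v. g' (0 + (D v - p (D v))))) (at \<Psi> within posdef_functions)"
    using has_derivative_compose[OF y] g'(1) unfolding X(2) .
  then have comp: "((\<lambda>\<Psi>. g (?y \<Psi>)) has_derivative (\<lambda>v. blinfun_apply R (D v - p (D v)))) (at \<Psi> within posdef_functions)"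
    by (simp add: g'R)
  have "(?y \<longlongrightarrow> ?y \<Psi>) (at \<Psi> within posdef_functions)"
    using has_derivative_continuous[OF y] by (simp add: continuous_within)
  then have "\<forall>\<^sub>F x in at \<Psi> within posdef_functions. ?y x \<in> V"
    using V X(2) by (auto intro: topological_tendstoD)
  moreover have "\<forall>\<^sub>F x in at \<Psi> within posdef_functions. x \<in> posdef_functions"
    by (simp add: eventually_at_filter)
  ultimately have "\<forall>\<^sub>F x in at \<Psi> within posdef_functions. g (?y x) = solution (pinv x)"
  proof eventually_elim
    case (elim x)
    have "pinv x \<in> herm_functions" using pinv_posdef[OF elim(2)] by (simp add: posdef_functions_eq)
    then have "sol (pinv x) (g (?y x))"
      using g[OF elim(1)] target_herm by (simp add: sol_iff)
    then show ?case by (rule solution_eqI[symmetric])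
  qed
  then show ?thesis
    by (rule has_derivative_transform_eventually[OF comp]) (use gX X(2) \<Psi> in simp_all)
qed

lemma Ck_on_pinv: "Ck_on n herm_functions posdef_functions pinv"
  by (rule pw.Ck_on_inverse[OF relatively_open_posdef _ _ herm.Ck_on_id])
    (simp_all add: pinv_accretive posdef_functions_accretive)

lemma Ck_on_solution: "Ck_on n herm_functions posdef_functions (\<lambda>\<Psi>. solution (pinv \<Psi>))"
proof (induction n)
  case 0
  have "continuous (at \<Psi> within posdef_functions) (\<lambda>\<Psi>. solution (pinv \<Psi>))"
    if \<Psi>: "\<Psi> \<in> posdef_functions" for \<Psi>
  proof -
    have "pinv (solution (pinv \<Psi>)) \<in> posdef_functions"
      using sol_solution[OF pinv_posdef[OF \<Psi>]] by (simp add: sol_def pinv_posdef)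
    then obtain R where "R o\<^sub>L DG (pinv (solution (pinv \<Psi>))) = id_blinfun"
      by (rule DG_inverse)
    from solution_has_derivative[OF \<Psi> this] show ?thesis by (rule has_derivative_continuous)
  qed
  then show ?case by (simp add: continuous_on_eq_continuous_within)
next
  case (Suc n)
  let ?Y = "\<lambda>\<Psi>. pinv (solution (pinv \<Psi>))"
  have P: "solution (pinv \<Psi>) \<in> posdef_functions" if "\<Psi> \<in> posdef_functions" for \<Psi>
    using sol_solution[OF pinv_posdef[OF that]] by (simp add: sol_def)
  have "\<exists>R. R o\<^sub>L DG (?Y \<Psi>) = id_blinfun \<and> DG (?Y \<Psi>) o\<^sub>L R = id_blinfun"
    if "\<Psi> \<in> posdef_functions" for \<Psi>
    using DG_inverse[OF pinv_posdef[OF P[OF that]]] by blast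
  then obtain R where R: "\<And>\<Psi>. \<Psi> \<in> posdef_functions \<Longrightarrow> R \<Psi> o\<^sub>L DG (?Y \<Psi>) = id_blinfun"
    "\<And>\<Psi>. \<Psi> \<in> posdef_functions \<Longrightarrow> DG (?Y \<Psi>) o\<^sub>L R \<Psi> = id_blinfun"
    by metis
  have Y: "Ck_on n herm_functions posdef_functions ?Y"
    by (rule pw.Ck_on_inverse[OF relatively_open_posdef _ _ Suc])
      (simp_all add: pinv_accretive posdef_functions_accretive P)
  have "Ck_on n herm_functions posdef_functions (\<lambda>\<Psi>. DG (?Y \<Psi>))"
    unfolding DG_def
    by (intro herm.Ck_on_diff herm.Ck_on_const herm.Ck_on_bilinear[OF bounded_bilinear_blinfun_compose]
        herm.Ck_on_linear[OF pw.bounded_linear_prod_right] herm.Ck_on_linear[OF pw.bounded_linear_prod_left] Y)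
  \<comment> \<open>Inversion in the algebra of bounded linear maps transfers order \<open>n\<close>
    from \<open>DG\<close> to its pointwise chosen inverse \<open>R\<close>; the derivative of the
    solution is then built from \<open>R\<close> and \<open>pinv \<Psi>\<close>.\<close>
  then have CR: "Ck_on n herm_functions posdef_functions R"
    by (rule unital_bilinear.Ck_on_inverse[OF unital_bilinear_blinfun_compose relatively_open_posdef, rotated 2])
      (simp_all add: R)
  show ?case
  proof (rule herm.Ck_on_SucI)
    show "((\<lambda>\<Psi>. solution (pinv \<Psi>)) has_derivative
        (\<lambda>v. blinfun_apply (R \<Psi>) (- pmult (pinv \<Psi>) (pmult v (pinv \<Psi>)) - p (- pmult (pinv \<Psi>) (pmult v (pinv \<Psi>))))))
      (at \<Psi> within posdef_functions)" if "\<Psi> \<in> posdef_functions" for \<Psi>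
      by (rule solution_has_derivative[OF that R(1)[OF that]])
    show "Ck_on n herm_functions posdef_functions
        (\<lambda>\<Psi>. blinfun_apply (R \<Psi>) (- pmult (pinv \<Psi>) (pmult v (pinv \<Psi>)) - p (- pmult (pinv \<Psi>) (pmult v (pinv \<Psi>)))))" for v
      by (intro herm.Ck_on_bilinear[OF bounded_bilinear_blinfun_apply] CR herm.Ck_on_diff herm.Ck_on_minus
          herm.Ck_on_linear[OF bounded_linear_p] herm.Ck_on_bilinear[OF bounded_bilinear_pmult]
          Ck_on_pinv herm.Ck_on_const)
  qed
qed

end

section \<open>Characters on the grid\<close>

lemma cis_sum: "cis (sum f A) = (\<Prod>x\<in>A. cis (f x))"
  by (induction A rule: infinite_finite_induct) (simp_all add: cis_mult[symmetric])

text \<open>A geometric sum with ratio \<open>w\<close> and \<open>w ^ n = 1\<close>. The ratio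
  differs from 1, because otherwise \<open>n\<close> would divide \<open>h\<close>, impossible for
  \<open>0 < \<bar>h\<bar> < n\<close>.\<close>

lemma sum_roots_of_unity_power:
  assumes h: "h \<noteq> 0" "\<bar>h\<bar> < int n"
  shows "(\<Sum>y\<in>{0..int n - 1}. cis (of_int h * (2 * pi * of_int y / of_nat n))) = 0"
proof -
  define w where "w = cis (2 * pi * of_int h / of_nat n)"
  have n: "n > 0" using h by (cases n) auto
  have "w ^ n = cis (2 * pi * of_int h)"
    using n by (simp add: w_def Complex.DeMoivre)
  then have wn: "w ^ n = 1" by simp
  have "w \<noteq> 1"
  proof
    assume "w = 1"
    then have "cos (2 * pi * of_int h / of_nat n) = 1" by (simp add: w_def complex_eq_iff)
    then obtain k :: int where "2 * pi * of_int h / of_nat n = of_int k * 2 * pi"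
      using cos_one_2pi_int by blast
    then have "real_of_int h = of_int (k * int n)" using n by (simp add: field_simps)
    then have "h = k * int n" by (simp only: of_int_eq_iff)
    then show False using h by (cases "k = 0") (auto simp: abs_mult)
  qed
  have "{0..int n - 1} = int ` {..<n}"
    using image_int_atLeastLessThan[of 0 n] by (auto simp: lessThan_atLeast0 atLeastLessThanPlusOne_atLeastAtMost_int[symmetric])
  then have "(\<Sum>y\<in>{0..int n - 1}. cis (of_int h * (2 * pi * of_int y / of_nat n)))
      = (\<Sum>y<n. cis (of_int h * (2 * pi * of_nat y / of_nat n)))"
    by (simp add: sum.reindex)
  also have "\<dots> = (\<Sum>y<n. w ^ y)"
    by (simp add: w_def Complex.DeMoivre mult_ac)
  also have "\<dots> = 0" using wn \<open>w \<noteq> 1\<close> by (simp add: geometric_sum)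
  finally show ?thesis .
qed

text \<open>As a product of integer intervals the grid admits the interchange of sum and
  product.\<close>

lemma grid_eq_image: "grid N = vec_lambda ` (PiE UNIV (\<lambda>j. {0..int (N $ j) - 1}))"
proof
  show "grid N \<subseteq> vec_lambda ` (PiE UNIV (\<lambda>j. {0..int (N $ j) - 1}))"
  proof
    fix l assume "l \<in> grid N"
    then have "vec_nth l \<in> PiE UNIV (\<lambda>j. {0..int (N $ j) - 1})" by (auto simp: grid_def)
    then show "l \<in> vec_lambda ` (PiE UNIV (\<lambda>j. {0..int (N $ j) - 1}))"
      by (metis imageI vec_nth_inverse)
  qed
qed (auto simp: grid_def PiE_iff)

lemma inj_vec_lambda: "inj_on vec_lambda A"
  by (simp add: inj_on_def vec_lambda_inject)

lemma card_grid: "card (grid N) = (\<Prod>j\<in>UNIV. N $ j)"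
  by (simp add: grid_eq_image card_image inj_vec_lambda card_PiE)

text \<open>The sum factors over the coordinates, and a coordinate with
  \<open>h $ j \<noteq> 0\<close> contributes a vanishing factor.\<close>

lemma sum_grid_character:
  fixes N :: "nat^'d"
  assumes h: "h \<noteq> 0" "\<And>j. \<bar>h $ j\<bar> < int (N $ j)"
  shows "(\<Sum>l\<in>grid N. cis (pairing h (angle N l))) = 0"
proof -
  obtain j where j: "h $ j \<noteq> 0" using h(1) by (auto simp: vec_eq_iff)
  let ?f = "\<lambda>j y. cis (of_int (h $ j) * (2 * pi * of_int y / of_nat (N $ j)))"
  have "(\<Sum>l\<in>grid N. cis (pairing h (angle N l)))
      = (\<Sum>f\<in>PiE UNIV (\<lambda>j. {0..int (N $ j) - 1}). \<Prod>j\<in>UNIV. ?f j (f j))"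
    unfolding grid_eq_image by (simp add: sum.reindex inj_vec_lambda pairing_def angle_def cis_sum)
  also have "\<dots> = (\<Prod>j\<in>UNIV. \<Sum>y\<in>{0..int (N $ j) - 1}. ?f j y)"
    by (rule prod_sum_PiE[symmetric]) auto
  also have "\<dots> = 0"
    using sum_roots_of_unity_power[OF j h(2)] by (intro prod_zero) auto
  finally show ?thesis .
qed

lemma inner_cscale: "inner (cscale c A) B = inner A (cscale (cnj c) B)"
proof -
  have "inner (c * a) b = inner a (cnj c * b)" for a b :: complex
    by (simp add: inner_complex_def algebra_simps)
  then show ?thesis by (simp add: inner_vec_def cscale_def)
qed

lemma ctranspose_cscale: "ctranspose (cscale c A) = cscale (cnj c) (ctranspose A)"
  by (simp add: ctranspose_def cscale_def vec_eq_iff)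

lemma linear_cscale: "linear (cscale c)"
  by (simp add: linear_iff cscale_def vec_eq_iff algebra_simps)

lemma linear_ctranspose: "linear ctranspose"
  by (simp add: linear_iff ctranspose_def vec_eq_iff)

section \<open>Moments and trigonometric polynomials in coordinates\<close>

locale moment_grid =
  fixes N :: "nat^'d" and \<Lambda> :: "(int^'d) set"
    and g :: "int^'d \<Rightarrow> 'g::finite" and e :: "'k::finite \<Rightarrow> int^'d"
  assumes N_pos: "0 < N $ j" and \<Lambda>_uminus: "k \<in> \<Lambda> \<Longrightarrow> - k \<in> \<Lambda>"
    and N_large: "int (N $ j) > 2 * Max ((\<lambda>k. \<bar>k $ j\<bar>) ` \<Lambda>)"
    and bij_g: "bij_betw g (grid N) UNIV" and bij_e: "bij_betw e UNIV \<Lambda>"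
begin

definition grid_point :: "'g \<Rightarrow> int^'d" where
  "grid_point = inv_into (grid N) g"

text \<open>The sign is that of the polynomial \<open>Q\<close>; moments therefore use the conjugate
  character.\<close>

definition character :: "'g \<Rightarrow> 'k \<Rightarrow> complex" where
  "character a b = cis (- pairing (e b) (angle N (grid_point a)))"

definition grid_size :: real where
  "grid_size = of_nat (\<Prod>j\<in>UNIV. N $ j)"

definition grid_values :: "complex^'m^'m^'k \<Rightarrow> complex^'m^'m^'g" where
  "grid_values q = (\<chi> a. \<Sum>b\<in>UNIV. cscale (character a b) (q $ b))"

definition moments :: "complex^'m^'m^'g \<Rightarrow> complex^'m^'m^'k" where
  "moments x = (\<chi> b. (1 / grid_size) *\<^sub>R (\<Sum>a\<in>UNIV. cscale (cnj (character a b)) (x $ a)))"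

definition neg :: "'k \<Rightarrow> 'k" where
  "neg b = inv e (- e b)"

definition conj_symmetric :: "complex^'m^'m^'k \<Rightarrow> bool" where
  "conj_symmetric q \<longleftrightarrow> (\<forall>b. q $ neg b = ctranspose (q $ b))"

lemma bij_grid_point: "bij_betw grid_point UNIV (grid N)"
  unfolding grid_point_def by (rule bij_betw_inv_into[OF bij_g])

lemma g_grid_point: "g (grid_point a) = a"
  using bij_g by (simp add: grid_point_def bij_betw_inv_into_right)

lemma e_in: "e b \<in> \<Lambda>"
  using bij_e by (auto simp: bij_betw_def)

lemma inj_e: "inj e"
  using bij_e by (simp add: bij_betw_def)

lemma e_neg: "e (neg b) = - e b"
  unfolding neg_def using bij_e \<Lambda>_uminus[OF e_in[of b]] by (intro f_inv_into_f) (simp add: bij_betw_def)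

lemma neg_neg: "neg (neg b) = b"
  using e_neg[of "neg b"] e_neg[of b] inj_e by (simp add: inj_eq)

lemma grid_size_pos: "grid_size > 0"
  unfolding grid_size_def using N_pos by (simp add: prod_pos)

lemma pairing_diff: "pairing (k - l) \<theta> = pairing k \<theta> - pairing l \<theta>"
  by (simp add: pairing_def algebra_simps sum_subtractf)

lemma character_neg: "character a (neg b) = cnj (character a b)"
  by (simp add: character_def e_neg cis_cnj pairing_def sum_negf)

text \<open>Two frequencies in \<open>\<Lambda>\<close> differ in coordinate \<open>j\<close> by at
  most twice the maximal modulus, hence by less than \<open>N $ j\<close>. This rules out aliasing
  on the grid.\<close>

lemma character_orthogonal: "(\<Sum>a\<in>UNIV. cnj (character a b) * character a c) = (if b = c then of_real grid_size else 0)"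
proof -
  have "(\<Sum>a\<in>UNIV. cnj (character a b) * character a c) = (\<Sum>a\<in>UNIV. cis (pairing (e b - e c) (angle N (grid_point a))))"
    by (simp add: character_def cis_cnj cis_mult pairing_diff)
  also have "\<dots> = (\<Sum>l\<in>grid N. cis (pairing (e b - e c) (angle N l)))"
    by (rule sum.reindex_bij_betw[OF bij_grid_point])
  also have "\<dots> = (if b = c then of_real grid_size else 0)"
  proof (cases "b = c")
    case True
    then show ?thesis by (simp add: pairing_def card_grid grid_size_def)
  next
    case False
    have "\<bar>(e b - e c) $ j\<bar> < int (N $ j)" for j
    proof -
      have "finite \<Lambda>" using bij_betw_finite[OF bij_e] by simp
      then have "\<bar>e d $ j\<bar> \<le> Max ((\<lambda>k. \<bar>k $ j\<bar>) ` \<Lambda>)" for d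
        using e_in by (intro Max_ge) auto
      from this[of b] this[of c] N_large[of j] show ?thesis by simp
    qed
    moreover have "e b - e c \<noteq> 0" using False inj_e by (simp add: inj_eq)
    ultimately show ?thesis using False sum_grid_character[of "e b - e c" N] by simp
  qed
  finally show ?thesis .
qed

lemma linear_moments: "linear moments"
  by (simp add: linear_iff moments_def vec_eq_iff linear_add[OF linear_cscale] linear_cmul[OF linear_cscale]
      sum.distrib scaleR_add_right scaleR_sum_right)

lemma linear_grid_values: "linear grid_values"
  by (simp add: linear_iff grid_values_def vec_eq_iff linear_add[OF linear_cscale] linear_cmul[OF linear_cscale]
      sum.distrib scaleR_sum_right)

text \<open>Fourier inversion on \<open>\<Lambda>\<close>, from orthogonality of the characters:
  \<open>grid_values\<close> is injective, and \<open>moments\<close> recovers the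
  coefficients.\<close>

lemma moments_grid_values: "moments (grid_values q) = q"
proof -
  have "(\<Sum>a\<in>UNIV. cnj (character a b) * (\<Sum>c\<in>UNIV. character a c * q $ c $ i $ j)) = of_real grid_size * q $ b $ i $ j" for b i j
  proof -
    have "(\<Sum>a\<in>UNIV. cnj (character a b) * (\<Sum>c\<in>UNIV. character a c * q $ c $ i $ j))
        = (\<Sum>a\<in>UNIV. \<Sum>c\<in>UNIV. cnj (character a b) * character a c * q $ c $ i $ j)"
      by (simp add: sum_distrib_left mult.assoc)
    also have "\<dots> = (\<Sum>c\<in>UNIV. (\<Sum>a\<in>UNIV. cnj (character a b) * character a c) * q $ c $ i $ j)"
      unfolding sum_distrib_right by (rule sum.swap)
    also have "\<dots> = (\<Sum>c\<in>UNIV. if b = c then of_real grid_size * q $ c $ i $ j else 0)"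
      unfolding character_orthogonal by (intro sum.cong) auto
    finally show ?thesis by simp
  qed
  moreover have "(1 / grid_size) *\<^sub>R (complex_of_real grid_size * z) = z" for z
    using grid_size_pos by (simp add: scaleR_conv_of_real)
  ultimately show ?thesis
    by (simp add: moments_def grid_values_def cscale_def vec_eq_iff)
qed

text \<open>Up to the factor \<open>grid_size\<close> the moment map is the adjoint of
  \<open>grid_values\<close>, which turns moment constraints into orthogonality.\<close>

lemma inner_grid_values: "inner (grid_values q) x = grid_size * inner q (moments x)"
proof -
  have "inner (grid_values q) x = (\<Sum>a\<in>UNIV. \<Sum>b\<in>UNIV. inner (q $ b) (cscale (cnj (character a b)) (x $ a)))"
    by (simp add: inner_vec_def[of _ x] grid_values_def inner_sum_left inner_cscale)
  also have "\<dots> = (\<Sum>b\<in>UNIV. inner (q $ b) (\<Sum>a\<in>UNIV. cscale (cnj (character a b)) (x $ a)))"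
    by (subst sum.swap) (simp add: inner_sum_right)
  also have "\<dots> = grid_size * inner q (moments x)"
    using grid_size_pos by (simp add: inner_vec_def[of q] moments_def sum_distrib_left)
  finally show ?thesis .
qed

lemma grid_values_hermitian:
  assumes "conj_symmetric q"
  shows "grid_values q \<in> herm_functions"
proof -
  have "ctranspose (grid_values q $ a) = grid_values q $ a" for a
  proof -
    have bij: "bij neg" using neg_neg by (metis bijI')
    have "ctranspose (grid_values q $ a) = (\<Sum>b\<in>UNIV. cscale (character a (neg b)) (q $ neg b))"
      using assms by (simp add: grid_values_def linear_sum[OF linear_ctranspose] ctranspose_cscale character_neg conj_symmetric_def)
    also have "\<dots> = (\<Sum>b\<in>UNIV. cscale (character a b) (q $ b))"
      by (rule sum.reindex_bij_betw[OF bij])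
    finally show ?thesis by (simp add: grid_values_def)
  qed
  then show ?thesis by (simp add: herm_functions_def hermitian_def)
qed

lemma moments_conj_symmetric:
  assumes "x \<in> herm_functions"
  shows "conj_symmetric (moments x)"
  using assms
  by (simp add: conj_symmetric_def moments_def herm_functions_def hermitian_def character_neg linear_cmul[OF linear_ctranspose]
      linear_sum[OF linear_ctranspose] ctranspose_cscale)

text \<open>By \<open>moments_grid_values\<close> these are exactly the values of
  conjugate-symmetric coefficient families.\<close>

definition range_space :: "(complex^'m^'m^'g) set" where
  "range_space = range grid_values \<inter> herm_functions"

lemma subspace_range_space: "subspace (range_space :: (complex^'m^'m^'g) set)"
  unfolding range_space_def
  by (intro subspace_inter subspace_herm_functions linear_subspace_image[OF linear_grid_values] subspace_UNIV)

text \<open>Testing against \<open>grid_values (moments R)\<close>, which is admissible because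
  \<open>R\<close> is Hermitian, yields the squared norm of the moments.\<close>

lemma orthogonal_range_space_iff:
  assumes R: "R \<in> herm_functions"
  shows "(\<forall>l\<in>range_space. inner R l = 0) \<longleftrightarrow> moments R = 0"
proof
  assume *: "\<forall>l\<in>range_space. inner R l = 0"
  have "grid_values (moments R) \<in> range_space"
    unfolding range_space_def using grid_values_hermitian[OF moments_conj_symmetric[OF R]] by blast
  then have "inner R (grid_values (moments R)) = 0" using * by blast
  then have "grid_size * inner (moments R) (moments R) = 0"
    by (simp add: inner_grid_values inner_commute[of R])
  then show "moments R = 0" using grid_size_pos by simp
next
  assume "moments R = 0"
  then show "\<forall>l\<in>range_space. inner R l = 0"
    by (auto simp: range_space_def inner_commute[of R] inner_grid_values)
qed

section \<open>Translation of the original problem into the abstract one\<close>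

definition coord :: "(int^'d \<Rightarrow> complex^'m^'m) \<Rightarrow> complex^'m^'m^'k" where
  "coord Q = (\<chi> b. Q (e b))"

definition family_of :: "complex^'m^'m^'k \<Rightarrow> int^'d \<Rightarrow> complex^'m^'m" where
  "family_of q k = (if k \<in> \<Lambda> then q $ inv e k else 0)"

definition gridvec :: "(int^'d \<Rightarrow> complex^'m^'m) \<Rightarrow> complex^'m^'m^'g" where
  "gridvec \<Psi> = (\<chi> a. \<Psi> (grid_point a))"

lemma e_inv: "k \<in> \<Lambda> \<Longrightarrow> e (inv e k) = k"
  using bij_e by (intro f_inv_into_f) (simp add: bij_betw_def)

lemma coord_family_of: "coord (family_of q) = q"
  by (simp add: coord_def family_of_def e_in inj_e vec_eq_iff)

lemma family_of_coord: "Q \<in> families \<Lambda> \<Longrightarrow> family_of (coord Q) = Q"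
  by (auto simp: coord_def family_of_def families_def e_inv)

lemma Q_space_iff: "Q \<in> Q_space \<Lambda> \<longleftrightarrow> Q \<in> families \<Lambda> \<and> conj_symmetric (coord Q)"
proof -
  have "(\<forall>k\<in>\<Lambda>. Q (- k) = ctranspose (Q k)) \<longleftrightarrow> (\<forall>b. Q (- e b) = ctranspose (Q (e b)))"
    using bij_e by (auto simp: bij_betw_def)
  then show ?thesis by (simp add: Q_space_def conj_symmetric_def coord_def e_neg)
qed

lemma trig_poly_eq: "trig_poly N \<Lambda> Q (grid_point a) = grid_values (coord Q) $ a"
  unfolding trig_poly_def grid_values_def coord_def character_def
  by (simp add: sum.reindex_bij_betw[OF bij_e, symmetric])

lemma moment_eq: "moment N F (e b) = moments (gridvec F) $ b"
  unfolding moment_def grid_avg_def moments_def gridvec_def character_def grid_size_def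
  by (simp add: sum.reindex_bij_betw[OF bij_grid_point, symmetric] cis_cnj)

lemma ball_grid_iff: "(\<forall>l\<in>grid N. P l) \<longleftrightarrow> (\<forall>a. P (grid_point a))"
  unfolding bij_grid_point[unfolded bij_betw_def, THEN conjunct2, symmetric] by blast

lemma ball_\<Lambda>_iff: "(\<forall>k\<in>\<Lambda>. P k) \<longleftrightarrow> (\<forall>b. P (e b))"
  using bij_e by (auto simp: bij_betw_def)

lemma posdef_on_grid_iff: "(\<forall>l\<in>grid N. posdef (F l)) \<longleftrightarrow> gridvec F \<in> posdef_functions"
  by (simp add: ball_grid_iff gridvec_def posdef_functions_def)

lemma is_solution_iff:
  "is_solution N \<Lambda> \<Psi> \<Sigma> Q \<longleftrightarrow> Q \<in> families \<Lambda> \<and> conj_symmetric (coord Q) \<and>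
    pinv (gridvec \<Psi>) + grid_values (coord Q) \<in> posdef_functions \<and>
    moments (pinv (pinv (gridvec \<Psi>) + grid_values (coord Q))) = coord \<Sigma>"
proof -
  let ?F = "\<lambda>l. matrix_inv (\<Psi> l) + trig_poly N \<Lambda> Q l"
  have F: "gridvec ?F = pinv (gridvec \<Psi>) + grid_values (coord Q)"
    by (simp add: gridvec_def pinv_def trig_poly_eq vec_eq_iff[where 'b = 'g])
  have "gridvec (\<lambda>l. matrix_inv (?F l)) = pinv (gridvec ?F)"
    by (simp add: gridvec_def pinv_def)
  then have "(\<forall>k\<in>\<Lambda>. moment N (\<lambda>l. matrix_inv (?F l)) k = \<Sigma> k) \<longleftrightarrow> moments (pinv (gridvec ?F)) = coord \<Sigma>"
    by (simp add: ball_\<Lambda>_iff moment_eq coord_def vec_eq_iff[where 'b = 'k])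
  then show ?thesis
    unfolding is_solution_def Q_space_iff posdef_on_grid_iff F by blast
qed

lemma affine_inverse_problem_range_space_exists:
  fixes \<Phi> :: "complex^'m^'m^'g"
  assumes "\<Phi> \<in> posdef_functions"
  obtains p where "affine_inverse_problem range_space p \<Phi>"
proof -
  obtain p :: "complex^'m^'m^'g \<Rightarrow> complex^'m^'m^'g" where "linear p" "\<And>x. p x \<in> range_space"
    "\<And>x l. l \<in> range_space \<Longrightarrow> inner (x - p x) l = 0"
    using orthogonal_projection_exists[OF subspace_range_space] by metis
  then show ?thesis
    using assms subspace_range_space
    by (intro that[of p]) (auto simp: affine_inverse_problem_def range_space_def)
qed

lemma coord_moment:
  assumes "\<And>k. k \<in> \<Lambda> \<Longrightarrow> \<Sigma> k = moment N F k"
  shows "coord \<Sigma> = moments (gridvec F)"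
  using assms[OF e_in] by (simp add: coord_def moment_eq vec_eq_iff[where 'b = 'k])

text \<open>Membership in the affine space is built into the form
  \<open>A + grid_values (coord Q)\<close>. Equality of moments says that
  \<open>pinv X - \<Phi>\<close> has zero moments, which is orthogonality to
  \<open>range_space\<close>.\<close>

lemma is_solution_iff_sol:
  fixes \<Psi> \<Sigma> :: "int^'d \<Rightarrow> complex^'m^'m"
  assumes "affine_inverse_problem range_space p (\<Phi> :: complex^'m^'m^'g)"
    and \<Sigma>: "coord \<Sigma> = moments \<Phi>" and \<Psi>: "gridvec \<Psi> \<in> posdef_functions"
  shows "is_solution N \<Lambda> \<Psi> \<Sigma> Q \<longleftrightarrow> Q \<in> families \<Lambda> \<and> conj_symmetric (coord Q) \<and>
    affine_inverse_problem.sol range_space \<Phi> (pinv (gridvec \<Psi>)) (pinv (gridvec \<Psi>) + grid_values (coord Q))"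
proof -
  interpret affine_inverse_problem range_space p \<Phi> by fact
  let ?X = "pinv (gridvec \<Psi>) + grid_values (coord Q)"
  have 1: "moments (pinv ?X) = coord \<Sigma> \<longleftrightarrow> (\<forall>l\<in>range_space. inner (pinv ?X - \<Phi>) l = 0)"
    if "?X \<in> posdef_functions"
  proof -
    have "pinv ?X - \<Phi> \<in> herm_functions"
      using pinv_posdef[OF that] \<Phi>_posdef
      by (intro subspace_diff[OF subspace_herm_functions]) (simp_all add: posdef_functions_eq)
    then show ?thesis
      by (simp add: orthogonal_range_space_iff linear_diff[OF linear_moments] \<Sigma>)
  qed
  have 2: "?X - pinv (gridvec \<Psi>) \<in> range_space" if "conj_symmetric (coord Q)"
    using grid_values_hermitian[OF that] by (simp add: range_space_def)
  show ?thesis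
    unfolding is_solution_iff sol_def using 1 2 by blast
qed

text \<open>The coefficients of the solving family are read off from \<open>solution A - A\<close>
  by Fourier inversion.\<close>

lemma ex1_is_solution:
  fixes \<Psi> \<Sigma> :: "int^'d \<Rightarrow> complex^'m^'m"
  assumes P: "affine_inverse_problem range_space p (\<Phi> :: complex^'m^'m^'g)"
    and \<Sigma>: "coord \<Sigma> = moments \<Phi>" and \<Psi>: "gridvec \<Psi> \<in> posdef_functions"
  defines "A \<equiv> pinv (gridvec \<Psi>)"
  defines "Q0 \<equiv> family_of (moments (affine_inverse_problem.solution range_space \<Phi> A - A))"
  shows "is_solution N \<Lambda> \<Psi> \<Sigma> Q0" and "is_solution N \<Lambda> \<Psi> \<Sigma> Q \<Longrightarrow> Q = Q0"
proof -
  interpret affine_inverse_problem range_space p \<Phi> by fact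
  note iff = is_solution_iff_sol[OF P \<Sigma> \<Psi>, folded A_def]
  have sol: "sol A (solution A)"
    unfolding A_def by (intro sol_solution pinv_posdef \<Psi>)
  then have "solution A - A \<in> range_space" by (simp add: sol_def)
  then obtain q where q: "solution A - A = grid_values q" and herm: "solution A - A \<in> herm_functions"
    by (auto simp: range_space_def)
  have Q0: "Q0 = family_of q" by (simp add: Q0_def q moments_grid_values)
  have "conj_symmetric q" using moments_conj_symmetric[OF herm] by (simp add: q moments_grid_values)
  moreover have "A + grid_values q = solution A" using q by (simp add: algebra_simps)
  ultimately show "is_solution N \<Lambda> \<Psi> \<Sigma> Q0"
    using sol by (simp add: iff Q0 coord_family_of families_def) (simp add: family_of_def)
  assume "is_solution N \<Lambda> \<Psi> \<Sigma> Q"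
  then have Q: "Q \<in> families \<Lambda>" "sol A (A + grid_values (coord Q))" by (simp_all add: iff)
  from solution_eqI[OF Q(2)] have "Q0 = family_of (coord Q)" by (simp add: Q0_def moments_grid_values)
  then show "Q = Q0" using family_of_coord[OF Q(1)] by simp
qed

lemma ex1_solution_and_smooth:
  fixes \<Sigma> :: "int^'d \<Rightarrow> complex^'m^'m"
  assumes \<Sigma>: "\<Sigma> \<in> moments_pos N \<Lambda>"
  shows "(\<forall>\<Psi>. (\<forall>l\<in>grid N. posdef (\<Psi> l)) \<longrightarrow> (\<exists>!Q. is_solution N \<Lambda> \<Psi> \<Sigma> Q)) \<and>
    smooth_on herm_functions posdef_functions (s_coord N \<Lambda> \<Sigma> g e)"
proof -
  obtain F where F: "\<forall>l\<in>grid N. posdef (F l)" "\<And>k. k \<in> \<Lambda> \<Longrightarrow> \<Sigma> k = moment N F k"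
    using \<Sigma> by (auto simp: moments_pos_def)
  define \<Phi> where "\<Phi> = gridvec F"
  have "\<Phi> \<in> posdef_functions" using F(1) by (simp add: \<Phi>_def posdef_on_grid_iff)
  from affine_inverse_problem_range_space_exists[OF this] obtain p where P: "affine_inverse_problem range_space p \<Phi>" .
  interpret affine_inverse_problem range_space p \<Phi> by fact
  have S: "coord \<Sigma> = moments \<Phi>" unfolding \<Phi>_def by (rule coord_moment[OF F(2)])
  note sol = ex1_is_solution[OF P S]
  have ex1: "\<exists>!Q. is_solution N \<Lambda> \<Psi> \<Sigma> Q" if "\<forall>l\<in>grid N. posdef (\<Psi> l)" for \<Psi>
    using sol[of \<Psi>] that unfolding posdef_on_grid_iff by blast
  \<comment> \<open>On positive definite functions \<open>s_coord\<close> is a linear image of two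
    maps already known to be of every order.\<close>
  have s: "s_coord N \<Lambda> \<Sigma> g e x = moments (solution (pinv x) - pinv x)" if x: "x \<in> posdef_functions" for x
  proof -
    have gx: "gridvec (\<lambda>l. x $ g l) = x" by (simp add: gridvec_def g_grid_point)
    have "s_map N \<Lambda> (\<lambda>l. x $ g l) \<Sigma> = family_of (moments (solution (pinv x) - pinv x))"
      unfolding s_map_def using sol[of "\<lambda>l. x $ g l", unfolded gx, OF x] by (rule the_equality)
    then show ?thesis using coord_family_of by (simp add: s_coord_def coord_def)
  qed
  have "Ck_on n herm_functions posdef_functions (s_coord N \<Lambda> \<Sigma> g e)" for n
  proof -
    have "Ck_on n herm_functions posdef_functions (\<lambda>x. moments (solution (pinv x) - pinv x))"
      by (intro herm.Ck_on_linear[OF linear_moments[THEN linear_conv_bounded_linear[THEN iffD1]]]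
          herm.Ck_on_diff Ck_on_solution Ck_on_pinv)
    then show ?thesis
      using herm.Ck_on_cong[of "s_coord N \<Lambda> \<Sigma> g e" "\<lambda>x. moments (solution (pinv x) - pinv x)" n, OF s] by blast
  qed
  then show ?thesis using ex1 unfolding smooth_on_def by blast
qed

end

text \<open>The first conjunct ensures that the definite description in \<open>s_map\<close> denotes
  the actual solution, so that the smoothness claim concerns the intended map.\<close>

theorem theorem3:
  fixes N :: "nat^'d" and \<Lambda> :: "(int^'d) set"
    and \<Sigma> :: "int^'d \<Rightarrow> complex^'m^'m"
    and g :: "int^'d \<Rightarrow> 'g::finite" and e :: "'k::finite \<Rightarrow> int^'d"
  assumes "\<forall>j. 0 < N $ j"
    and "finite \<Lambda>" and "0 \<in> \<Lambda>" and "\<forall>k\<in>\<Lambda>. - k \<in> \<Lambda>"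
    and "\<forall>j. int (N $ j) > 2 * Max ((\<lambda>k. \<bar>k $ j\<bar>) ` \<Lambda>)"
    and "\<Sigma> \<in> moments_pos N \<Lambda>"
    and "bij_betw g (grid N) UNIV" and "bij_betw e UNIV \<Lambda>"
  shows "(\<forall>\<Psi>. (\<forall>l\<in>grid N. posdef (\<Psi> l)) \<longrightarrow> (\<exists>!Q. is_solution N \<Lambda> \<Psi> \<Sigma> Q)) \<and>
    smooth_on herm_functions posdef_functions (s_coord N \<Lambda> \<Sigma> g e)"
proof -
  interpret moment_grid N \<Lambda> g e
    using assms by unfold_locales auto
  show ?thesis by (rule ex1_solution_and_smooth) fact
qed

end
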